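(* Let $(T(t))_{t\ge0}$ be a $C_0$-semigroup on a Banach space $X$ with generator $A$, and let $s_R(A)$ be the resolvent bound of $A$. Then $s_R(A)$ is admissible.
   Context: All Banach spaces are complex and infinite-dimensional. $\sigma_e(A)=\{\lambda\in\mathbb C:\lambda-A\text{ is not Fredholm}\}$, $s_e(A)=\sup\{\operatorname{Re}\lambda:\lambda\in\sigma_e(A)\}$, $\sigma_p(A)$ is the point spectrum of $A$, $R(\lambda,A)=(\lambda-A)^{-1}$ is the resolvent, $A^*$ is the adjoint of $A$ with domain $D(A^* )\subset X^*$, and $\operatorname{Ker}$ denotes the kernel. The resolvent bound $s_R(A)$ is the infimum of the set of all $a>s_e(A)$ satisfying $$\operatorname{card}\bigl(\sigma_p(A)\cap(a+i\mathbb R)\bigr)<\infty\quad\text{and}\quad\limsup_{|b|\to\infty}\|R(a+ib,A)\|<\infty.$$ A number $\omega\in\mathbb R$ is called admissible (for $(T(t))_{t\ge0}$) if for every $t_0>0$, every $\varepsilon>0$ and every subspace $M\subset X$ of the form $M=\bigcap_{1\le j\le n}\operatorname{Ker}y_j^*$ with $y_j^*\in D(A^* )$ for $j\in\{1,\dots,n\}$, there exist $x\in M$ with $\|x\|=1$ and $\mu\in\mathbb C$ with $\operatorname{Re}\mu=\omega$ such that $$\|T(t)x-e^{\mu t}x\|<\varepsilon,\qquad 0\le t\le t_0.$$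
   Formalization: The formal theorem assumes that s_R(A) is not −∞ (which occurs, e.g., for nilpotent semigroups), because admissibility is defined only for real numbers; that s_R(A) < ∞ is proved. *)

theory Defs
  imports "HOL-Analysis.Analysis"
begin

class complex_normed_vector = real_normed_vector +
  fixes scaleC :: "complex \<Rightarrow> 'a \<Rightarrow> 'a" (infixr \<open>*\<^sub>C\<close> 75)
  assumes scaleC_add_right: "c *\<^sub>C (x + y) = c *\<^sub>C x + c *\<^sub>C y"
    and scaleC_add_left: "(c + d) *\<^sub>C x = c *\<^sub>C x + d *\<^sub>C x"
    and scaleC_scaleC: "c *\<^sub>C (d *\<^sub>C x) = (c * d) *\<^sub>C x"
    and scaleC_of_real: "complex_of_real r *\<^sub>C x = r *\<^sub>R x"
    and norm_scaleC: "norm (c *\<^sub>C x) = cmod c * norm x"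

class complex_banach = complex_normed_vector + complete_space
begin

subclass banach ..

end

instantiation complex :: complex_banach
begin

definition scaleC_complex :: "complex \<Rightarrow> complex \<Rightarrow> complex" where
  "scaleC_complex c x = c * x"

instance
  by standard (auto simp: scaleC_complex_def algebra_simps norm_mult scaleR_conv_of_real)

end

global_interpretation complex_vector: vector_space "scaleC :: complex \<Rightarrow> 'a \<Rightarrow> 'a::complex_normed_vector"
proof
  fix x :: 'a
  show "1 *\<^sub>C x = x"
    using scaleC_of_real[of 1 x] by simp
qed (simp_all add: scaleC_add_right scaleC_add_left scaleC_scaleC)

definition finite_dimensional :: "'a::complex_normed_vector set \<Rightarrow> bool" where
  "finite_dimensional S \<longleftrightarrow> (\<exists>B. finite B \<and> S \<subseteq> complex_vector.span B)"

definition finite_codimensional :: "'a::complex_normed_vector set \<Rightarrow> bool" where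
  "finite_codimensional S \<longleftrightarrow> (\<exists>B. finite B \<and> complex_vector.span (S \<union> B) = UNIV)"

definition bounded_clinear :: "('a::complex_normed_vector \<Rightarrow> 'b::complex_normed_vector) \<Rightarrow> bool" where
  "bounded_clinear f \<longleftrightarrow> bounded_linear f \<and> (\<forall>c x. f (c *\<^sub>C x) = c *\<^sub>C f x)"

text \<open>A possibly unbounded operator in a space. The values of \<open>opfun\<close> outside
  \<open>opdom\<close> carry no meaning, and every notion below ignores them.\<close>

record 'a unbounded_op =
  opdom :: "'a set"
  opfun :: "'a \<Rightarrow> 'a"

definition shifted :: "complex \<Rightarrow> 'a::complex_normed_vector unbounded_op \<Rightarrow> 'a \<Rightarrow> 'a" where
  "shifted l A x = l *\<^sub>C x - opfun A x"

text \<open>The condition that \<open>\<lambda> - A\<close> is Fredholm. For closed operators \<open>A\<close> on a Banach space,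
  in particular for generators, closedness of the range follows from finite codimension.\<close>

definition fredholm_at :: "complex \<Rightarrow> 'a::complex_normed_vector unbounded_op \<Rightarrow> bool" where
  "fredholm_at l A \<longleftrightarrow>
     finite_dimensional {x \<in> opdom A. shifted l A x = 0} \<and>
     closed (shifted l A ` opdom A) \<and>
     finite_codimensional (shifted l A ` opdom A)"

definition essential_spectrum :: "'a::complex_normed_vector unbounded_op \<Rightarrow> complex set" where
  "essential_spectrum A = {l. \<not> fredholm_at l A}"

text \<open>The value is \<open>-\<infinity>\<close> if the essential spectrum is empty.\<close>

definition essential_spectral_bound :: "'a::complex_normed_vector unbounded_op \<Rightarrow> ereal" where
  "essential_spectral_bound A = (SUP l\<in>essential_spectrum A. ereal (Re l))"

definition point_spectrum :: "'a::complex_normed_vector unbounded_op \<Rightarrow> complex set" where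
  "point_spectrum A = {l. \<exists>x\<in>opdom A. x \<noteq> 0 \<and> opfun A x = l *\<^sub>C x}"

definition resolvent :: "complex \<Rightarrow> 'a::complex_normed_vector unbounded_op \<Rightarrow> 'a \<Rightarrow> 'a" where
  "resolvent l A = inv_into (opdom A) (shifted l A)"

definition resolvent_set :: "'a::complex_normed_vector unbounded_op \<Rightarrow> complex set" where
  "resolvent_set A =
     {l. bij_betw (shifted l A) (opdom A) UNIV \<and> bounded_clinear (resolvent l A)}"

text \<open>The operator norm of the resolvent, with value \<open>\<infinity>\<close> where the resolvent does not exist.\<close>

definition resolvent_norm :: "complex \<Rightarrow> 'a::complex_normed_vector unbounded_op \<Rightarrow> ereal" where
  "resolvent_norm l A = (if l \<in> resolvent_set A then ereal (onorm (resolvent l A)) else \<infinity>)"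

text \<open>On the real line, \<open>at_infinity\<close> is the filter of \<open>\<bar>b\<bar> \<rightarrow> \<infinity>\<close>.\<close>

definition resolvent_bound :: "'a::complex_normed_vector unbounded_op \<Rightarrow> ereal" where
  "resolvent_bound A = Inf {ereal a | a :: real.
     essential_spectral_bound A < ereal a \<and>
     finite (point_spectrum A \<inter> {l. Re l = a}) \<and>
     Limsup at_infinity (\<lambda>b :: real. resolvent_norm (Complex a b) A) < \<infinity>}"

text \<open>The domain of the adjoint: the functionals \<open>f\<close> in the dual space for which
  \<open>f \<circ> A\<close> extends to a functional \<open>g\<close> in the dual space.\<close>

definition adjoint_dom :: "'a::complex_normed_vector unbounded_op \<Rightarrow> ('a \<Rightarrow> complex) set" where
  "adjoint_dom A =
     {f. bounded_clinear f \<and> (\<exists>g. bounded_clinear g \<and> (\<forall>x\<in>opdom A. f (opfun A x) = g x))}"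

definition C0_semigroup :: "(real \<Rightarrow> 'a::complex_normed_vector \<Rightarrow> 'a) \<Rightarrow> bool" where
  "C0_semigroup T \<longleftrightarrow>
     (\<forall>t\<ge>0. bounded_clinear (T t)) \<and>
     T 0 = id \<and>
     (\<forall>s\<ge>0. \<forall>t\<ge>0. T (s + t) = T s \<circ> T t) \<and>
     (\<forall>x. continuous_on {0..} (\<lambda>t. T t x))"

definition generator :: "(real \<Rightarrow> 'a::complex_normed_vector \<Rightarrow> 'a) \<Rightarrow> 'a unbounded_op" where
  "generator T =
     \<lparr>opdom = {x. \<exists>y. ((\<lambda>h. (T h x - x) /\<^sub>R h) \<longlongrightarrow> y) (at_right 0)},
      opfun = (\<lambda>x. Lim (at_right 0) (\<lambda>h. (T h x - x) /\<^sub>R h))\<rparr>"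

definition admissible :: "(real \<Rightarrow> 'a::complex_normed_vector \<Rightarrow> 'a) \<Rightarrow> real \<Rightarrow> bool" where
  "admissible T \<omega> \<longleftrightarrow>
     (\<forall>t\<^sub>0>0. \<forall>\<epsilon>>0. \<forall>M.
        (\<exists>(n::nat) y. (\<forall>j\<in>{1..n}. y j \<in> adjoint_dom (generator T)) \<and>
                      M = (\<Inter>j\<in>{1..n}. {x. y j x = 0})) \<longrightarrow>
        (\<exists>x\<in>M. norm x = 1 \<and>
           (\<exists>\<mu>. Re \<mu> = \<omega> \<and>
              (\<forall>t\<in>{0..t\<^sub>0}. norm (T t x - exp (\<mu> * complex_of_real t) *\<^sub>C x) < \<epsilon>))))"

end

theory Submission
  imports Defs "HOL-Complex_Analysis.Complex_Analysis"
begin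

text \<open>Write \<open>\<omega>\<close> for the resolvent bound of \<open>A\<close>. It is smaller than \<open>\<infinity>\<close>, since far to the right the resolvent
  of a generator exists and is bounded (\<open>resolvent_bound_generator_not_infinity\<close>). Suppose that \<open>\<omega>\<close> is not
  admissible, as witnessed by \<open>t0\<close>, \<open>\<epsilon>\<close> and \<open>M = \<Inter>j. Ker y\<^sub>j\<close>.

  If \<open>(l - A) x\<close> is small, then Duhamel's formula shows that \<open>T(t) x\<close> is close to \<open>exp (l t) x\<close> on \<open>[0, t0]\<close>.
  So the failure of admissibility forbids approximate eigenvectors of \<open>A\<close> in \<open>M\<close> for all \<open>l\<close> in a thin strip
  around the line \<open>Re = \<omega>\<close>: there is a lower bound \<open>c \<parallel>x\<parallel> \<le> \<parallel>(l - A) x\<parallel>\<close> for \<open>x \<in> D(A) \<inter> M\<close>. For large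
  \<open>l\<close> the same bound holds on all of \<open>D(A)\<close>, because the \<open>y\<^sub>j\<close> belong to \<open>D(A\<^sup>*)\<close>: approximate eigenvectors for
  large \<open>l\<close> are almost annihilated by them and can be moved into \<open>M\<close> at small cost
  (\<open>lower_bounds_of_not_almost_exponential\<close>).

  A lower bound on a subspace of finite codimension says that \<open>l - A\<close> is upper semi-Fredholm. The strip is
  connected and contains regular points, so stability of the index and the analytic Fredholm theorem
  suggest that \<open>l - A\<close> is Fredholm throughout the strip and invertible outside a small set. This is proved in
  an elementary form, for affine families of bounded operators, with a countable exceptional set
  (\<open>invertible_off_countable_on_connected\<close>). The bounded family comes from multiplying \<open>l - A\<close> by the resolvent at
  one regular point. Countability already yields a line \<open>Re = a'\<close> with \<open>a' < \<omega>\<close> in the strip without any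
  spectrum. On it the resolvent is bounded for large imaginary parts, and the essential spectrum stays
  strictly to the left. Thus \<open>a'\<close> is one of the numbers whose infimum is \<open>\<omega>\<close>, which is absurd
  (\<open>no_lower_bounds_near_resolvent_bound\<close>).\<close>

section \<open>Complex-linear bounded operators\<close>

lemma bounded_clinear_imp_bounded_linear: "bounded_clinear f \<Longrightarrow> bounded_linear f"
  by (simp add: bounded_clinear_def)

lemma bounded_clinear_scaleC: "bounded_clinear f \<Longrightarrow> f (c *\<^sub>C x) = c *\<^sub>C f x"
  by (simp add: bounded_clinear_def)

lemma bounded_clinear_simps:
  assumes "bounded_clinear f"
  shows "f (x + y) = f x + f y" "f (x - y) = f x - f y" "f 0 = 0" "f (- x) = - f x"
    "f (c *\<^sub>C x) = c *\<^sub>C f x"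
proof -
  interpret bounded_linear f
    using assms by (rule bounded_clinear_imp_bounded_linear)
  show "f (x + y) = f x + f y" "f (x - y) = f x - f y" "f 0 = 0" "f (- x) = - f x"
    by (rule add diff zero neg)+
  show "f (c *\<^sub>C x) = c *\<^sub>C f x"
    using assms by (rule bounded_clinear_scaleC)
qed

lemma bounded_bilinear_scaleC: "bounded_bilinear (scaleC :: complex \<Rightarrow> 'a::complex_normed_vector \<Rightarrow> 'a)"
proof
  show "(r *\<^sub>R a) *\<^sub>C b = r *\<^sub>R a *\<^sub>C b" for r a and b :: 'a
    unfolding scaleR_conv_of_real by (simp add: scaleC_of_real[of r, symmetric] scaleC_scaleC)
  show "a *\<^sub>C r *\<^sub>R b = r *\<^sub>R a *\<^sub>C b" for r a and b :: 'a
    by (simp add: scaleC_of_real[symmetric] scaleC_scaleC mult.commute)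
  show "\<exists>K. \<forall>a (b :: 'a). norm (a *\<^sub>C b) \<le> norm a * norm b * K"
    by (intro exI[of _ 1]) (simp add: norm_scaleC)
qed (simp_all add: scaleC_add_left scaleC_add_right)

lemmas continuous_on_scaleC [continuous_intros] =
  bounded_bilinear.continuous_on [OF bounded_bilinear_scaleC]

lemmas tendsto_scaleC = bounded_bilinear.tendsto [OF bounded_bilinear_scaleC]

lemmas scaleC_right_bounded_linear = bounded_bilinear.bounded_linear_right [OF bounded_bilinear_scaleC]

lemmas scaleC_left_bounded_linear = bounded_bilinear.bounded_linear_left [OF bounded_bilinear_scaleC]

lemma bounded_clinear_id: "bounded_clinear (\<lambda>x. x)"
  by (simp add: bounded_clinear_def)

lemma bounded_clinear_compose:
  assumes "bounded_clinear f" "bounded_clinear g"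
  shows "bounded_clinear (\<lambda>x. f (g x))"
  using assms bounded_linear_compose[of f g] by (auto simp: bounded_clinear_def)

lemma bounded_clinear_add:
  assumes "bounded_clinear f" "bounded_clinear g"
  shows "bounded_clinear (\<lambda>x. f x + g x)"
  using assms by (auto simp: bounded_clinear_def scaleC_add_right intro: bounded_linear_add)

lemma bounded_clinear_diff:
  assumes "bounded_clinear f" "bounded_clinear g"
  shows "bounded_clinear (\<lambda>x. f x - g x)"
  using assms
  by (auto simp: bounded_clinear_def complex_vector.scale_right_diff_distrib intro: bounded_linear_sub)

lemma bounded_clinear_const_scaleC:
  assumes "bounded_clinear f"
  shows "bounded_clinear (\<lambda>x. c *\<^sub>C f x)"
  using assms bounded_linear_compose[OF scaleC_right_bounded_linear, of f c]
  by (auto simp: bounded_clinear_def scaleC_scaleC mult.commute)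

lemma bounded_clinear_scaleC_const:
  assumes "bounded_clinear (f :: 'a::complex_normed_vector \<Rightarrow> complex)"
  shows "bounded_clinear (\<lambda>x. f x *\<^sub>C v)"
  using assms bounded_linear_compose[OF scaleC_left_bounded_linear, of f v]
  by (auto simp: bounded_clinear_def scaleC_scaleC scaleC_complex_def)

lemmas bounded_clinear_intros =
  bounded_clinear_id bounded_clinear_add bounded_clinear_diff
  bounded_clinear_const_scaleC bounded_clinear_scaleC_const

lemma bounded_clinear_bound:
  assumes "bounded_clinear f"
  obtains K where "K > 0" "\<And>x. norm (f x) \<le> K * norm x"
  using bounded_linear.pos_bounded[OF bounded_clinear_imp_bounded_linear[OF assms]]
  by (metis mult.commute)

section \<open>Bounded invertibility and rank one perturbations\<close>

text \<open>The inverse is bounded through a lower bound on \<open>B\<close>, because lower bounds are the quantities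
  which all arguments below trace through perturbations.\<close>

definition boundedly_invertible :: "('a::complex_normed_vector \<Rightarrow> 'a) \<Rightarrow> bool" where
  "boundedly_invertible B \<longleftrightarrow>
     bounded_clinear B \<and> surj B \<and> (\<exists>c>0. \<forall>u. c * norm u \<le> norm (B u))"

lemma boundedly_invertibleD:
  assumes "boundedly_invertible B"
  shows "bounded_clinear B" "bij B"
proof -
  show B: "bounded_clinear B"
    using assms by (simp add: boundedly_invertible_def)
  obtain c where c: "c > 0" "\<And>u. c * norm u \<le> norm (B u)"
    using assms by (auto simp: boundedly_invertible_def)
  have "inj B"
  proof (rule injI)
    fix x y assume "B x = B y"
    then show "x = y"
      using c(2)[of "x - y"] c(1) by (simp add: bounded_clinear_simps[OF B] mult_le_0_iff)
  qed
  then show "bij B"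
    using assms by (simp add: bij_def boundedly_invertible_def)
qed

lemma bounded_clinear_inv:
  assumes "boundedly_invertible B" "c > 0" "\<And>u. c * norm u \<le> norm (B u)"
  shows "bounded_clinear (inv B)" "norm (inv B x) \<le> norm x / c"
proof -
  note B = boundedly_invertibleD[OF assms(1)]
  have [simp]: "B (inv B x) = x" "inv B (B x) = x" for x
    using B(2) by (simp_all add: bij_is_surj surj_f_inv_f bij_is_inj)
  have bd: "norm (inv B x) \<le> norm x / c" for x
    using assms(3)[of "inv B x"] assms(2) by (simp add: field_simps)
  have eqI: "x = y" if "B x = B y" for x y
    using that B(2) by (metis bij_is_inj injD)
  have sc: "inv B (a *\<^sub>C x) = a *\<^sub>C inv B x" for a x
    by (rule eqI) (simp add: bounded_clinear_simps[OF B(1)])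
  have "bounded_linear (inv B)"
  proof (rule bounded_linear_intro[where K = "1 / c"])
    show "inv B (x + y) = inv B x + inv B y" for x y
      by (rule eqI) (simp add: bounded_clinear_simps[OF B(1)])
    show "inv B (r *\<^sub>R x) = r *\<^sub>R inv B x" for r x
      using sc[of "complex_of_real r" x] by (simp add: scaleC_of_real)
    show "norm (inv B x) \<le> norm x * (1 / c)" for x
      using bd[of x] by simp
  qed
  with sc show "bounded_clinear (inv B)"
    by (simp add: bounded_clinear_def)
  show "norm (inv B x) \<le> norm x / c" by (rule bd)
qed

lemma boundedly_invertibleI:
  assumes "bounded_clinear B" "bounded_clinear C" "\<And>u. B (C u) = u" "\<And>u. C (B u) = u"
  shows "boundedly_invertible B"
proof -
  obtain K where K: "K > 0" "\<And>x. norm (C x) \<le> K * norm x"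
    using bounded_clinear_bound[OF assms(2)] by blast
  have "1 / K * norm u \<le> norm (B u)" for u
    using K(2)[of "B u"] K(1) by (simp add: assms(4) field_simps)
  moreover have "surj B"
    using assms(3) by (metis surjI)
  ultimately show ?thesis
    unfolding boundedly_invertible_def using assms(1) K(1)
    by (meson zero_less_divide_1_iff)
qed

lemma boundedly_invertible_id: "boundedly_invertible (\<lambda>u. u)"
  by (intro boundedly_invertibleI[where C = "\<lambda>u. u"] bounded_clinear_id) auto

lemma boundedly_invertible_compose:
  assumes "boundedly_invertible B" "boundedly_invertible C"
  shows "boundedly_invertible (\<lambda>u. B (C u))"
proof -
  obtain b c where b: "b > 0" "\<And>u. b * norm u \<le> norm (B u)"
    and c: "c > 0" "\<And>u. c * norm u \<le> norm (C u)"
    using assms by (auto simp: boundedly_invertible_def)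
  have "(b * c) * norm u \<le> norm (B (C u))" for u
    unfolding mult.assoc
    by (rule order_trans[OF mult_left_mono[OF c(2)[of u] less_imp_le[OF b(1)]] b(2)[of "C u"]])
  moreover have "surj (\<lambda>u. B (C u))"
    using comp_surj[of C B] assms by (simp add: boundedly_invertible_def comp_def)
  ultimately show ?thesis
    unfolding boundedly_invertible_def
    using mult_pos_pos[OF b(1) c(1)]
      bounded_clinear_compose[OF boundedly_invertibleD(1)[OF assms(1)] boundedly_invertibleD(1)[OF assms(2)]]
    by blast
qed

text \<open>A right-hand side is reached by the fixed point iteration for
  \<open>u = B\<inverse>(x - E u)\<close>, which contracts with the factor \<open>e / c\<close>.\<close>

lemma boundedly_invertible_perturb:
  fixes B E :: "'a::complex_banach \<Rightarrow> 'a"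
  assumes "boundedly_invertible B" "\<And>u. c * norm u \<le> norm (B u)"
    and "bounded_clinear E" "\<And>u. norm (E u) \<le> e * norm u" "0 \<le> e" "e < c"
  shows "boundedly_invertible (\<lambda>u. B u + E u)"
    and "(c - e) * norm u \<le> norm (B u + E u)"
proof -
  have c: "c > 0" using assms by simp
  note B = boundedly_invertibleD[OF assms(1)]
  note inv = bounded_clinear_inv[OF assms(1) c assms(2)]
  have low: "(c - e) * norm u \<le> norm (B u + E u)" for u
    using norm_diff_ineq[of "B u" "E u"] assms(2)[of u] assms(4)[of u]
    by (simp add: left_diff_distrib)
  have "surj (\<lambda>u. B u + E u)"
    unfolding surj_def
  proof
    fix x
    have "\<exists>!u. inv B (x - E u) = u"
    proof (rule banach_fix_type)
      show "0 \<le> e / c" "e / c < 1" using assms c by auto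
      show "\<forall>u v. dist (inv B (x - E u)) (inv B (x - E v)) \<le> e / c * dist u v"
      proof (intro allI)
        fix u v
        have "inv B (x - E u) - inv B (x - E v) = inv B (E (v - u))"
          by (simp add: bounded_clinear_simps[OF inv(1)] bounded_clinear_simps[OF assms(3)])
        then have "norm (inv B (x - E u) - inv B (x - E v)) \<le> norm (E (v - u)) / c"
          using inv(2) by simp
        also have "\<dots> \<le> e * norm (v - u) / c"
          using assms(4)[of "v - u"] c by (simp add: divide_right_mono)
        finally show "dist (inv B (x - E u)) (inv B (x - E v)) \<le> e / c * dist u v"
          by (simp add: dist_norm norm_minus_commute)
      qed
    qed
    then obtain u where "inv B (x - E u) = u" by blast
    then have "B u = x - E u"
      using surj_f_inv_f[OF bij_is_surj[OF B(2)], of "x - E u"] by simp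
    then show "\<exists>u. x = B u + E u"
      by (intro exI[of _ u]) simp
  qed
  then show "boundedly_invertible (\<lambda>u. B u + E u)"
    using low assms(6) bounded_clinear_add[OF B(1) assms(3)]
    by (auto simp: boundedly_invertible_def intro!: exI[of _ "c - e"])
  show "(c - e) * norm u \<le> norm (B u + E u)"
    by (rule low)
qed

text \<open>The Sherman--Morrison formula for a rank one perturbation of the identity.\<close>

lemma boundedly_invertible_rank_one:
  assumes f: "bounded_clinear f" and s: "1 + f w \<noteq> (0::complex)"
  shows "boundedly_invertible (\<lambda>u. u + f u *\<^sub>C w)"
proof (rule boundedly_invertibleI)
  show "bounded_clinear (\<lambda>u. u + f u *\<^sub>C w)"
    using f by (intro bounded_clinear_intros)
  have eq: "u - (f u / (1 + f w)) *\<^sub>C w = u - (1 / (1 + f w)) *\<^sub>C f u *\<^sub>C w" for u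
    by (simp add: scaleC_scaleC)
  show "bounded_clinear (\<lambda>u. u - (f u / (1 + f w)) *\<^sub>C w)"
    unfolding eq using f by (intro bounded_clinear_intros)
  show "u - (f u / (1 + f w)) *\<^sub>C w + f (u - (f u / (1 + f w)) *\<^sub>C w) *\<^sub>C w = u" for u
  proof -
    have "f (u - (f u / (1 + f w)) *\<^sub>C w) = f u / (1 + f w)"
      using s by (simp add: bounded_clinear_simps[OF f] scaleC_complex_def field_simps)
    then show ?thesis by simp
  qed
  show "u + f u *\<^sub>C w - (f (u + f u *\<^sub>C w) / (1 + f w)) *\<^sub>C w = u" for u
  proof -
    have "f (u + f u *\<^sub>C w) / (1 + f w) = f u"
      using s by (simp add: bounded_clinear_simps[OF f] scaleC_complex_def field_simps)
    then show ?thesis by simp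
  qed
qed

text \<open>A rank one perturbation can trade one functional of a finite-codimensional lower bound for a
  lower bound on the larger space, and the new bound \<open>c'\<close> depends on \<open>c\<close> and \<open>z\<close> but not on \<open>B\<close>. This
  uniformity is what later permits passing to a limit point of invertible operators.
  The perturbation precomposes \<open>B\<close> with an operator that fixes \<open>Ker f\<close> and sends \<open>z\<close> to a multiple of
  some \<open>z' \<in> z + (N \<inter> Ker f)\<close>; as in the lemma of F. Riesz, \<open>z'\<close> is chosen such that the norm of
  \<open>B z'\<close> is at most twice the distance of \<open>B z'\<close> from \<open>B (N \<inter> Ker f)\<close>.\<close>

lemma rank_one_extension_of_lower_bound:
  fixes B :: "'a::complex_normed_vector \<Rightarrow> 'a" and f :: "'a \<Rightarrow> complex"
  assumes B: "boundedly_invertible B" and f: "bounded_clinear f"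
    and N: "complex_vector.subspace N" and z: "z \<in> N" "f z = 1"
    and c: "c > 0" "\<And>u. u \<in> N \<Longrightarrow> f u = 0 \<Longrightarrow> c * norm u \<le> norm (B u)"
  defines "c' \<equiv> 1 / (3 / c + norm z)"
  shows "\<exists>v. boundedly_invertible (\<lambda>u. B u + f u *\<^sub>C v) \<and>
    (\<forall>u\<in>N. c' * norm u \<le> norm (B u + f u *\<^sub>C v))"
proof -
  note fs = bounded_clinear_simps[OF f, unfolded scaleC_complex_def]
  note Bc = boundedly_invertibleD(1)[OF B]
  note Bs = bounded_clinear_simps[OF Bc]
  define Z where "Z = B ` (N \<inter> {u. f u = 0})"
  have "0 \<in> Z"
    unfolding Z_def using N complex_vector.subspace_0 Bs(3) fs(3)
    by (metis (mono_tags, lifting) IntI image_eqI mem_Collect_eq)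
  obtain b where b: "b > 0" "\<And>u. b * norm u \<le> norm (B u)"
    using B by (auto simp: boundedly_invertible_def)
  obtain K where K: "K > 0" "\<And>u. norm (f u) \<le> K * norm u"
    using bounded_clinear_bound[OF f] by blast
  define d where "d = infdist (B z) Z"
  \<comment> \<open>\<open>B z\<close> has positive distance from \<open>Z\<close> because \<open>f\<close> is bounded and \<open>B\<close> is bounded below.\<close>
  have "b / K \<le> dist (B z) y" if y: "y \<in> Z" for y
  proof -
    obtain n where n: "y = B n" "f n = 0" using y unfolding Z_def by blast
    have "1 \<le> K * norm (z - n)"
      using K(2)[of "z - n"] by (simp add: fs n z)
    then have "b / K \<le> b * norm (z - n)"
      using b(1) K(1) by (simp add: field_simps)
    also have "\<dots> \<le> dist (B z) y"
      using b(2)[of "z - n"] by (simp add: n dist_norm Bs)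
    finally show ?thesis .
  qed
  then have "b / K \<le> d"
    unfolding d_def using \<open>0 \<in> Z\<close> by (subst infdist_notempty) (auto intro!: cINF_greatest)
  with b K have d: "d > 0" by (smt (verit) divide_pos_pos)
  have "\<exists>y\<in>Z. dist (B z) y < 2 * d"
  proof (rule ccontr)
    assume "\<not> ?thesis"
    then have "2 * d \<le> infdist (B z) Z"
      using \<open>0 \<in> Z\<close> by (subst infdist_notempty) (auto intro!: cINF_greatest simp: not_less)
    with d show False by (simp add: d_def)
  qed
  then obtain n where n: "n \<in> N" "f n = 0" "norm (B z - B n) < 2 * d"
    unfolding Z_def dist_norm by blast
  \<comment> \<open>The scaling by \<open>1 / d\<close> puts \<open>s B z'\<close> at distance \<open>1\<close> from \<open>Z\<close>, with norm at most \<open>2\<close>.\<close>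
  define s where "s = complex_of_real (1 / d)"
  define z' where "z' = z - n"
  define w where "w = s *\<^sub>C z' - z"
  have "1 + f w = s"
    by (simp add: w_def z'_def fs z n)
  then have "1 + f w \<noteq> 0" using d by (simp add: s_def)
  then have inv: "boundedly_invertible (\<lambda>u. B (u + f u *\<^sub>C w))"
    by (intro boundedly_invertible_compose[OF B] boundedly_invertible_rank_one[OF f])
  moreover have "c' * norm u \<le> norm (B (u + f u *\<^sub>C w))" if u: "u \<in> N" for u
  proof -
    define v where "v = u - f u *\<^sub>C z"
    have v: "v \<in> N" "f v = 0"
      using u z N by (auto simp: v_def fs complex_vector.subspace_diff complex_vector.subspace_scale)
    define r where "r = norm (B (u + f u *\<^sub>C w))"
    have eq: "B (u + f u *\<^sub>C w) = B v + (f u * s) *\<^sub>C B z'"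
      by (simp add: v_def w_def Bs complex_vector.scale_right_diff_distrib scaleC_scaleC)
    have "norm (f u) \<le> r"
    proof (cases "f u = 0")
      case False
      have dz: "d \<le> norm (B z' + y)" if y: "y \<in> Z" for y
      proof -
        obtain m where m: "m \<in> N" "f m = 0" "y = B m" using y unfolding Z_def by blast
        then have "B (n - m) \<in> Z"
          using n N unfolding Z_def
          by (auto simp: fs intro!: imageI complex_vector.subspace_diff)
        then have "d \<le> dist (B z) (B (n - m))"
          unfolding d_def by (rule infdist_le)
        then show ?thesis
          by (simp add: dist_norm Bs z'_def m algebra_simps)
      qed
      have s0: "s \<noteq> 0" using d by (simp add: s_def)
      have "(1 / (f u * s)) *\<^sub>C v \<in> N \<inter> {u. f u = 0}"
        using v N by (auto simp: fs complex_vector.subspace_scale)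
      then have "B ((1 / (f u * s)) *\<^sub>C v) \<in> Z"
        unfolding Z_def by (rule imageI)
      from dz[OF this] have "norm (f u * s) * d \<le> norm (f u * s) * norm (B z' + (1 / (f u * s)) *\<^sub>C B v)"
        by (intro mult_left_mono) (auto simp: Bs)
      also have "\<dots> = norm ((f u * s) *\<^sub>C (B z' + (1 / (f u * s)) *\<^sub>C B v))"
        by (simp add: norm_scaleC)
      also have "(f u * s) *\<^sub>C (B z' + (1 / (f u * s)) *\<^sub>C B v) = B (u + f u *\<^sub>C w)"
        using False s0 unfolding eq by (simp add: scaleC_add_right scaleC_scaleC)
      finally show ?thesis
        using d by (simp add: norm_mult s_def r_def norm_divide)
    qed (simp add: r_def)
    moreover have "norm ((f u * s) *\<^sub>C B z') \<le> 2 * norm (f u)"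
    proof -
      have "norm ((f u * s) *\<^sub>C B z') = norm (f u) * (norm (B z - B n) / d)"
        using d by (simp add: norm_scaleC norm_mult s_def z'_def Bs norm_divide)
      also have "\<dots> \<le> norm (f u) * 2"
        using n(3) d by (intro mult_left_mono) (auto simp: field_simps)
      finally show ?thesis by simp
    qed
    moreover have "norm (B v) \<le> r + norm ((f u * s) *\<^sub>C B z')"
      using norm_triangle_ineq4[of "B v + (f u * s) *\<^sub>C B z'" "(f u * s) *\<^sub>C B z'"]
      by (simp add: r_def eq)
    ultimately have "c * norm v \<le> 3 * r" "norm (f u) \<le> r"
      using c(2)[OF v] by linarith+
    then have "norm v \<le> 3 / c * r" "norm (f u) * norm z \<le> r * norm z"
      using c(1) by (simp add: field_simps, intro mult_right_mono norm_ge_zero)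
    moreover have "norm u \<le> norm v + norm (f u) * norm z"
      using norm_triangle_ineq[of v "f u *\<^sub>C z"] by (simp add: v_def norm_scaleC)
    ultimately have "norm u \<le> (3 / c + norm z) * r"
      unfolding distrib_right mult.commute[of "norm z" r] by linarith
    moreover have "3 / c + norm z > 0"
      using c(1) by (simp add: add_pos_nonneg)
    ultimately show ?thesis
      by (simp add: c'_def r_def field_simps)
  qed
  moreover have "B (u + f u *\<^sub>C w) = B u + f u *\<^sub>C B w" for u
    by (simp add: Bs)
  ultimately show ?thesis by auto
qed

section \<open>Finite-codimensional lower bounds along an affine family of operators\<close>

definition common_kernel :: "('a \<Rightarrow> complex) list \<Rightarrow> 'a set" where
  "common_kernel fs = {u. \<forall>f\<in>set fs. f u = 0}"

lemma common_kernel_Nil [simp]: "common_kernel [] = UNIV"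
  and common_kernel_Cons [simp]: "common_kernel (f # fs) = common_kernel fs \<inter> {u. f u = 0}"
  by (auto simp: common_kernel_def)

lemma subspace_common_kernel:
  assumes "\<And>f. f \<in> set fs \<Longrightarrow> bounded_clinear f"
  shows "complex_vector.subspace (common_kernel fs)"
  using assms
  by (auto simp: complex_vector.subspace_def common_kernel_def bounded_clinear_simps scaleC_complex_def)

lemma common_kernel_normalized_vector:
  fixes f :: "'a::complex_normed_vector \<Rightarrow> complex"
  assumes "bounded_clinear f" "\<And>g. g \<in> set fs \<Longrightarrow> bounded_clinear g"
    and "u \<in> common_kernel fs" "f u \<noteq> 0"
  obtains z where "z \<in> common_kernel fs" "f z = 1"
proof
  show "(1 / f u) *\<^sub>C u \<in> common_kernel fs"
    using subspace_common_kernel[of fs] assms by (simp add: complex_vector.subspace_scale)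
  show "f ((1 / f u) *\<^sub>C u) = 1"
    using assms by (simp add: bounded_clinear_simps scaleC_complex_def)
qed

lemma boundedly_invertible_affine:
  fixes B R :: "'a::complex_banach \<Rightarrow> 'a"
  assumes B: "boundedly_invertible B" "\<And>u. c * norm u \<le> norm (B u)"
    and R: "bounded_clinear R" "\<And>u. norm (R u) \<le> K * norm u"
    and K: "K > 0" and l: "norm l * K < c"
  shows "boundedly_invertible (\<lambda>u. B u + l *\<^sub>C R u)"
    and "(c - norm l * K) * norm u \<le> norm (B u + l *\<^sub>C R u)"
proof -
  have *: "norm (l *\<^sub>C R u) \<le> norm l * K * norm u" for u
    using mult_left_mono[OF R(2)[of u] norm_ge_zero[of l]] by (simp add: norm_scaleC mult.assoc)
  show "boundedly_invertible (\<lambda>u. B u + l *\<^sub>C R u)"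
    "(c - norm l * K) * norm u \<le> norm (B u + l *\<^sub>C R u)"
    using K l by (intro boundedly_invertible_perturb[OF B bounded_clinear_const_scaleC[OF R(1)] *]; simp)+
qed

lemma affine_recenter:
  "B u + m *\<^sub>C R u = (B u + l *\<^sub>C R u) + (m - l) *\<^sub>C (R u :: 'a::complex_normed_vector)"
  by (simp add: complex_vector.scale_left_diff_distrib)

lemma boundedly_invertible_affine_nearby:
  fixes B R :: "'a::complex_banach \<Rightarrow> 'a"
  assumes R: "bounded_clinear R" and l: "boundedly_invertible (\<lambda>u. B u + l *\<^sub>C R u)"
  obtains r c where "r > 0" "c > 0"
    "\<And>m. dist m l < r \<Longrightarrow> boundedly_invertible (\<lambda>u. B u + m *\<^sub>C R u)"
    "\<And>m u. dist m l < r \<Longrightarrow> c * norm u \<le> norm (B u + m *\<^sub>C R u)"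
proof -
  obtain K where K: "K > 0" "\<And>u. norm (R u) \<le> K * norm u"
    using bounded_clinear_bound[OF R] by blast
  obtain c where c: "c > 0" "\<And>u. c * norm u \<le> norm (B u + l *\<^sub>C R u)"
    using l by (auto simp: boundedly_invertible_def)
  show thesis
  proof
    show "c / (2 * K) > 0" "c / 2 > 0" using c K by auto
    fix m assume "dist m l < c / (2 * K)"
    then have m: "norm (m - l) * K < c / 2"
      using K by (simp add: dist_norm field_simps)
    then have m': "norm (m - l) * K < c" using c by simp
    note * = boundedly_invertible_affine[OF l c(2) R K(2) K(1) m', folded affine_recenter]
    show "boundedly_invertible (\<lambda>u. B u + m *\<^sub>C R u)" by (rule *(1))
    show "c / 2 * norm u \<le> norm (B u + m *\<^sub>C R u)" for u
      using *(2)[of u] mult_right_mono[of "c / 2" "c - norm (m - l) * K" "norm u"] m by simp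
  qed
qed

lemma open_boundedly_invertible_affine:
  fixes B R :: "'a::complex_banach \<Rightarrow> 'a"
  assumes "bounded_clinear R"
  shows "open {l. boundedly_invertible (\<lambda>u. B u + l *\<^sub>C R u)}"
  unfolding open_dist
proof
  fix l assume "l \<in> {l. boundedly_invertible (\<lambda>u. B u + l *\<^sub>C R u)}"
  then have "boundedly_invertible (\<lambda>u. B u + l *\<^sub>C R u)" by simp
  then obtain r where "r > 0" "\<And>m. dist m l < r \<Longrightarrow> boundedly_invertible (\<lambda>u. B u + m *\<^sub>C R u)"
    using boundedly_invertible_affine_nearby[OF assms] by metis
  then show "\<exists>e>0. \<forall>m. dist m l < e \<longrightarrow> m \<in> {l. boundedly_invertible (\<lambda>u. B u + l *\<^sub>C R u)}"
    by (intro exI[of _ r]) simp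
qed

text \<open>The resolvent identity \<open>x\<^sub>m - x\<^sub>l = - (m - l) (B + m R)\<inverse> R x\<^sub>l\<close> gives the derivative.\<close>

lemma holomorphic_on_solution:
  fixes B R :: "'a::complex_banach \<Rightarrow> 'a"
  assumes B: "bounded_clinear B" and R: "bounded_clinear R" and f: "bounded_clinear f"
    and D: "\<And>l. l \<in> D \<Longrightarrow> boundedly_invertible (\<lambda>u. B u + l *\<^sub>C R u)" "open D"
  shows "(\<lambda>l. f (inv (\<lambda>u. B u + l *\<^sub>C R u) v)) holomorphic_on D"
proof -
  define G where "G l = inv (\<lambda>u. B u + l *\<^sub>C R u)" for l
  note Rs = bounded_clinear_simps[OF R] and Bs = bounded_clinear_simps[OF B]
    and fs = bounded_clinear_simps[OF f, unfolded scaleC_complex_def]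
  have G: "B (G l v) + l *\<^sub>C R (G l v) = v" if "l \<in> D" for l v
    unfolding G_def
    using surj_f_inv_f[OF bij_is_surj[OF boundedly_invertibleD(2)[OF D(1)[OF that]]], of v] .
  have G_unique: "G l (B u + l *\<^sub>C R u) = u" if "l \<in> D" for l u
    unfolding G_def
    using inv_f_f[OF bij_is_inj[OF boundedly_invertibleD(2)[OF D(1)[OF that]]], of u] .
  have ident: "G m v - G l v = - (m - l) *\<^sub>C G m (R (G l v))" if "m \<in> D" "l \<in> D" for m l v
  proof -
    have "B (- (m - l) *\<^sub>C G m (R (G l v))) + m *\<^sub>C R (- (m - l) *\<^sub>C G m (R (G l v)))
        = - (m - l) *\<^sub>C (B (G m (R (G l v))) + m *\<^sub>C R (G m (R (G l v))))"
      by (simp add: Bs Rs scaleC_add_right scaleC_scaleC mult.commute)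
    also have "\<dots> = - (m - l) *\<^sub>C R (G l v)"
      using that by (simp add: G)
    also have "\<dots> = v - (B (G l v) + m *\<^sub>C R (G l v))"
      using G[OF that(2), of v] by (simp add: complex_vector.scale_left_diff_distrib algebra_simps)
    also have "\<dots> = B (G m v - G l v) + m *\<^sub>C R (G m v - G l v)"
      using G[OF that(1), of v]
      by (simp add: Bs Rs complex_vector.scale_right_diff_distrib algebra_simps)
    finally show ?thesis
      using G_unique[OF that(1)] by metis
  qed
  have cont: "((\<lambda>m. G m v) \<longlongrightarrow> G l v) (at l)" if l: "l \<in> D" for l v
  proof -
    obtain r c where rc: "r > 0" "c > 0"
      "\<And>m. dist m l < r \<Longrightarrow> boundedly_invertible (\<lambda>u. B u + m *\<^sub>C R u)"
      "\<And>m u. dist m l < r \<Longrightarrow> c * norm u \<le> norm (B u + m *\<^sub>C R u)"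
      using boundedly_invertible_affine_nearby[OF R D(1)[OF l]] by metis
    have ev: "\<forall>\<^sub>F m in at l. dist m l < r \<and> m \<in> D"
      using rc(1) l D(2)
      by (intro eventually_conj eventually_at_in_open') (auto simp: eventually_at)
    have "((\<lambda>m. G m v - G l v) \<longlongrightarrow> 0) (at l)"
    proof (rule Lim_null_comparison)
      show "\<forall>\<^sub>F m in at l. norm (G m v - G l v) \<le> norm (m - l) * (norm (R (G l v)) / c)"
        using ev
      proof eventually_elim
        case (elim m)
        have "c * norm (G m (R (G l v))) \<le> norm (R (G l v))"
          using rc(4)[of m "G m (R (G l v))"] elim by (simp add: G)
        then have "norm (G m (R (G l v))) \<le> norm (R (G l v)) / c"
          unfolding pos_le_divide_eq[OF rc(2)] by (simp only: mult.commute)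
        then show ?case
          using elim l
          by (simp only: ident norm_scaleC norm_minus_cancel) (intro mult_left_mono norm_ge_zero)
      qed
      show "((\<lambda>m. norm (m - l) * (norm (R (G l v)) / c)) \<longlongrightarrow> 0) (at l)"
        using rc(2) by (auto intro!: tendsto_eq_intros)
    qed
    then show ?thesis by (simp add: LIM_zero_iff)
  qed
  have "((\<lambda>l. f (G l v)) has_field_derivative - f (G l (R (G l v)))) (at l)" if l: "l \<in> D" for l
    unfolding has_field_derivative_iff
  proof (rule Lim_transform_eventually)
    show "((\<lambda>m. - f (G m (R (G l v)))) \<longlongrightarrow> - f (G l (R (G l v)))) (at l)"
      by (intro tendsto_minus bounded_linear.tendsto[OF bounded_clinear_imp_bounded_linear[OF f]] cont l)
    have "\<forall>\<^sub>F m in at l. m \<in> D" "\<forall>\<^sub>F m in at l. m \<noteq> l"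
      using eventually_at_in_open'[OF D(2) l] by (auto simp: eventually_at_filter elim: eventually_mono)
    then show "\<forall>\<^sub>F m in at l. - f (G m (R (G l v))) = (f (G m v) - f (G l v)) / (m - l)"
    proof eventually_elim
      case (elim m)
      have "f (G m v) - f (G l v) = - (m - l) * f (G m (R (G l v)))"
        using elim l by (simp add: ident fs flip: fs(2))
      then show ?case using elim by (simp add: field_simps)
    qed
  qed
  then show ?thesis
    unfolding G_def using D(2) by (auto simp: holomorphic_on_open)
qed

lemma holomorphic_zeros_countable:
  assumes "h holomorphic_on D" "open D" "connected D" "z \<in> D" "h z \<noteq> 0"
  shows "countable {l \<in> D. h l = 0}"
proof (cases "h constant_on D")
  case True
  then have "{l \<in> D. h l = 0} = {}" using assms by (auto simp: constant_on_def)
  then show ?thesis by (metis countable_empty)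
next
  case False
  obtain F :: "nat \<Rightarrow> complex set" where "\<And>n. compact (F n)" "\<Union> (range F) = D"
    using open_Union_compact_subsets[OF assms(2)] by metis
  then have "fsigma D"
    unfolding fsigma_Union_compact by (intro exI[of _ F]) (simp add: image_subset_iff)
  with assms False show ?thesis
    by (intro holomorphic_countable_zeros)
qed


definition finite_rank_diff :: "('a::complex_normed_vector \<Rightarrow> 'a) \<Rightarrow> ('a \<Rightarrow> 'a) \<Rightarrow> bool" where
  "finite_rank_diff G K \<longleftrightarrow> (\<exists>S. finite S \<and> (\<forall>u. G u - K u \<in> complex_vector.span S))"

lemma boundedly_invertible_minus_rank_one:
  assumes B: "boundedly_invertible B" and f: "bounded_clinear f" and "f (inv B v) \<noteq> (1 :: complex)"
  shows "boundedly_invertible (\<lambda>u. B u - f u *\<^sub>C v)"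
proof -
  note Bc = boundedly_invertibleD[OF B]
  have f': "bounded_clinear (\<lambda>u. - f u)"
    using bounded_clinear_const_scaleC[OF f, of "-1"] by (simp add: scaleC_complex_def)
  have "boundedly_invertible (\<lambda>u. B (u + (- f u) *\<^sub>C inv B v))"
    using assms(3) by (intro boundedly_invertible_compose[OF B] boundedly_invertible_rank_one[OF f']) simp
  moreover have "B (u + (- f u) *\<^sub>C inv B v) = B u - f u *\<^sub>C v" for u
    using surj_f_inv_f[OF bij_is_surj[OF Bc(2)], of v] by (simp add: bounded_clinear_simps[OF Bc(1)])
  ultimately show ?thesis by simp
qed

text \<open>A form of the analytic Fredholm theorem. The functionals are removed one at a time: by
  \<open>rank_one_extension_of_lower_bound\<close> there is a rank one perturbation \<open>B'\<close> of \<open>B\<close> which is bounded below on the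
  kernel of one functional less, so \<open>B' + l R\<close> is invertible for all \<open>l\<close> in a disc outside a countable
  set. There \<open>B + l R\<close> is invertible unless the scalar holomorphic function
  \<open>f ((B' + l R)\<inverse> v) - 1\<close> vanishes. A disc minus a countable set is connected, and the function
  does not vanish at \<open>0\<close>, because \<open>B\<close> itself is invertible. Hence its zeros are again countable. Asking
  for a countable instead of a discrete exceptional set avoids poles and determinants. The radius \<open>\<eta>\<close>
  does not depend on \<open>B\<close>.\<close>

lemma invertible_off_countable_near_invertible:
  fixes R :: "'a::complex_banach \<Rightarrow> 'a" and fs :: "('a \<Rightarrow> complex) list"
  assumes R: "bounded_clinear R" and fs: "\<forall>f\<in>set fs. bounded_clinear f" and "c > 0"
  shows "\<exists>\<eta>>0. \<forall>B. boundedly_invertible B \<longrightarrow> (\<forall>u\<in>common_kernel fs. c * norm u \<le> norm (B u)) \<longrightarrow>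
    countable {l \<in> ball 0 \<eta>. \<not> boundedly_invertible (\<lambda>u. B u + l *\<^sub>C R u)} \<and>
    (\<forall>l\<in>ball 0 \<eta>. \<exists>G. boundedly_invertible G \<and> finite_rank_diff G (\<lambda>u. B u + l *\<^sub>C R u))"
  using fs \<open>c > 0\<close>
proof (induction fs arbitrary: c)
  case Nil
  obtain K where K: "K > 0" "\<And>u. norm (R u) \<le> K * norm u"
    using bounded_clinear_bound[OF R] by blast
  have inv: "boundedly_invertible (\<lambda>u. B u + l *\<^sub>C R u)"
    if "boundedly_invertible B" "\<forall>u. c * norm u \<le> norm (B u)" "l \<in> ball 0 (c / K)" for B l
    using that K(1) by (intro boundedly_invertible_affine(1)[OF _ _ R K(2) K(1)]) (auto simp: field_simps)
  have refl: "finite_rank_diff G G" for G :: "'a \<Rightarrow> 'a"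
    by (auto simp: finite_rank_diff_def intro!: exI[of _ "{}"])
  have "countable {l \<in> ball 0 (c / K). \<not> boundedly_invertible (\<lambda>u. B u + l *\<^sub>C R u)}"
    if "boundedly_invertible B" "\<forall>u. c * norm u \<le> norm (B u)" for B
  proof -
    have "{l \<in> ball 0 (c / K). \<not> boundedly_invertible (\<lambda>u. B u + l *\<^sub>C R u)} = {}"
      using inv[OF that] by blast
    then show ?thesis by (metis countable_empty)
  qed
  moreover have "\<exists>G. boundedly_invertible G \<and> finite_rank_diff G (\<lambda>u. B u + l *\<^sub>C R u)"
    if "boundedly_invertible B" "\<forall>u. c * norm u \<le> norm (B u)" "l \<in> ball 0 (c / K)" for B l
    by (intro exI[of _ "\<lambda>u. B u + l *\<^sub>C R u"] conjI inv[OF that] refl)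
  moreover have "c / K > 0" using Nil(2) K(1) by simp
  ultimately show ?case
    unfolding common_kernel_Nil by (intro exI[of _ "c / K"] conjI allI impI ballI) simp_all
next
  case (Cons f fs)
  have f: "bounded_clinear f" and fs: "\<forall>g\<in>set fs. bounded_clinear g"
    using Cons.prems by auto
  show ?case
  proof (cases "\<exists>u\<in>common_kernel fs. f u \<noteq> 0")
    case False
    then have "common_kernel (f # fs) = common_kernel fs" by auto
    then show ?thesis using Cons.IH[OF fs Cons.prems(2)] by simp
  next
    case True
    then obtain z where z: "z \<in> common_kernel fs" "f z = 1"
      using common_kernel_normalized_vector[OF f bspec[OF fs]] by metis
    define c' where "c' = 1 / (3 / c + norm z)"
    have "c' > 0" using Cons.prems(2) by (simp add: c'_def add_pos_nonneg)
    from Cons.IH[OF fs this] obtain \<eta> where \<eta>: "\<eta> > 0" and IH':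
      "\<forall>B. boundedly_invertible B \<longrightarrow> (\<forall>u\<in>common_kernel fs. c' * norm u \<le> norm (B u)) \<longrightarrow>
        countable {l \<in> ball 0 \<eta>. \<not> boundedly_invertible (\<lambda>u. B u + l *\<^sub>C R u)} \<and>
        (\<forall>l\<in>ball 0 \<eta>. \<exists>G. boundedly_invertible G \<and> finite_rank_diff G (\<lambda>u. B u + l *\<^sub>C R u))"
      by (elim exE conjE) (rule that)
    note IH = IH'[rule_format, THEN conjunct1] bspec[OF IH'[rule_format, THEN conjunct2]]
    have *: "countable {l \<in> ball 0 \<eta>. \<not> boundedly_invertible (\<lambda>u. B u + l *\<^sub>C R u)} \<and>
      (\<forall>l\<in>ball 0 \<eta>. \<exists>G. boundedly_invertible G \<and> finite_rank_diff G (\<lambda>u. B u + l *\<^sub>C R u))"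
      if B: "boundedly_invertible B" and low: "\<forall>u\<in>common_kernel (f # fs). c * norm u \<le> norm (B u)" for B
    proof -
      have low': "c * norm u \<le> norm (B u)" if "u \<in> common_kernel fs" "f u = 0" for u
        using low that by simp
      obtain v where v: "boundedly_invertible (\<lambda>u. B u + f u *\<^sub>C v)"
        "\<forall>u\<in>common_kernel fs. c' * norm u \<le> norm (B u + f u *\<^sub>C v)"
        unfolding c'_def
        using rank_one_extension_of_lower_bound[OF B f subspace_common_kernel[OF bspec[OF fs]] z Cons.prems(2) low']
        by blast
      define B' where "B' = (\<lambda>u. B u + f u *\<^sub>C v)"
      have B': "boundedly_invertible B'" "\<forall>u\<in>common_kernel fs. c' * norm u \<le> norm (B' u)"
        unfolding B'_def by (rule v)+
      define D where "D = {l \<in> ball 0 \<eta>. boundedly_invertible (\<lambda>u. B' u + l *\<^sub>C R u)}"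
      define h where "h l = f (inv (\<lambda>u. B' u + l *\<^sub>C R u) v) - 1" for l
      have "D = ball 0 \<eta> \<inter> {l. boundedly_invertible (\<lambda>u. B' u + l *\<^sub>C R u)}"
        unfolding D_def by blast
      then have "open D"
        using open_Int[OF open_ball open_boundedly_invertible_affine[OF R]] by simp
      have "D = ball 0 \<eta> - {l \<in> ball 0 \<eta>. \<not> boundedly_invertible (\<lambda>u. B' u + l *\<^sub>C R u)}"
        unfolding D_def by blast
      then have "connected D"
        using connected_open_diff_countable[OF _ open_ball connected_ball IH(1)[OF B'(1) bspec[OF B'(2)]]] by simp
      have "h holomorphic_on D"
        unfolding h_def using \<open>open D\<close>
        by (intro holomorphic_intros holomorphic_on_solution[OF boundedly_invertibleD(1)[OF B'(1)] R f])
          (auto simp: D_def)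
      moreover have "0 \<in> D"
        using \<eta> B'(1) by (simp add: D_def)
      moreover have "h 0 \<noteq> 0"
      proof
        assume "h 0 = 0"
        define x where "x = inv B' v"
        have "B' x = v"
          unfolding x_def using surj_f_inv_f[OF bij_is_surj[OF boundedly_invertibleD(2)[OF B'(1)]]] .
        moreover have "f x = 1"
          using \<open>h 0 = 0\<close> by (simp add: h_def x_def)
        ultimately have "B x = B 0"
          using boundedly_invertibleD[OF B] by (simp add: B'_def bounded_clinear_simps)
        then have "x = 0"
          using boundedly_invertibleD(2)[OF B] by (metis bij_is_inj injD)
        with \<open>f x = 1\<close> show False
          using bounded_clinear_simps(3)[OF f] by simp
      qed
      ultimately have zeros: "countable {l \<in> D. h l = 0}"
        using \<open>open D\<close> \<open>connected D\<close> by (intro holomorphic_zeros_countable)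
      have B_eq: "B u + l *\<^sub>C R u = (B' u + l *\<^sub>C R u) - f u *\<^sub>C v" for u l
        by (simp add: B'_def)
      have "boundedly_invertible (\<lambda>u. B u + l *\<^sub>C R u)" if "l \<in> D" "h l \<noteq> 0" for l
        unfolding B_eq using that
        by (intro boundedly_invertible_minus_rank_one[OF _ f]) (auto simp: D_def h_def)
      then have sub: "{l \<in> ball 0 \<eta>. \<not> boundedly_invertible (\<lambda>u. B u + l *\<^sub>C R u)} \<subseteq>
        {l \<in> ball 0 \<eta>. \<not> boundedly_invertible (\<lambda>u. B' u + l *\<^sub>C R u)} \<union> {l \<in> D. h l = 0}"
        by (auto simp: D_def)
      have "countable {l \<in> ball 0 \<eta>. \<not> boundedly_invertible (\<lambda>u. B u + l *\<^sub>C R u)}"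
        by (rule countable_subset[OF sub countable_Un[OF IH(1)[OF B'(1) bspec[OF B'(2)]] zeros]])
      moreover have "\<exists>G. boundedly_invertible G \<and> finite_rank_diff G (\<lambda>u. B u + l *\<^sub>C R u)"
        if l: "l \<in> ball 0 \<eta>" for l
      proof -
        obtain G S where G: "boundedly_invertible G" and S: "finite S"
          "\<And>u. G u - (B' u + l *\<^sub>C R u) \<in> complex_vector.span S"
          using IH(2)[OF B'(1) bspec[OF B'(2)] l] by (auto simp: finite_rank_diff_def)
        have "G u - (B u + l *\<^sub>C R u) \<in> complex_vector.span (insert v S)" for u
        proof -
          have "G u - (B' u + l *\<^sub>C R u) \<in> complex_vector.span (insert v S)"
            using S(2)[of u] complex_vector.span_mono[OF subset_insertI[of S v]] by blast
          moreover have "f u *\<^sub>C v \<in> complex_vector.span (insert v S)"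
            by (intro complex_vector.span_scale complex_vector.span_base) simp
          ultimately have "G u - (B' u + l *\<^sub>C R u) + f u *\<^sub>C v \<in> complex_vector.span (insert v S)"
            by (rule complex_vector.span_add)
          then show ?thesis by (simp add: B'_def algebra_simps)
        qed
        then have "finite_rank_diff G (\<lambda>u. B u + l *\<^sub>C R u)"
          unfolding finite_rank_diff_def using S(1) by (intro exI[of _ "insert v S"]) simp
        with G show ?thesis by (intro exI conjI)
      qed
      ultimately show ?thesis by (intro conjI ballI)
    qed
    show ?thesis by (intro exI[of _ \<eta>] conjI[OF \<eta>] allI impI) (rule *)
  qed
qed

text \<open>The set of points near which only countably many operators fail to be invertible is open by
  definition. It is closed in \<open>U\<close>, since at a limit point \<open>l\<close> there are invertible operators
  arbitrarily near, and the discs of uniform radius around them, from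
  \<open>invertible_off_countable_near_invertible\<close>, contain \<open>l\<close>. So it is all of \<open>U\<close>.\<close>

lemma invertible_off_countable_on_connected:
  fixes B R :: "'a::complex_banach \<Rightarrow> 'a"
  assumes R: "bounded_clinear R" and fs: "\<forall>f\<in>set fs. bounded_clinear f"
    and U: "open U" "connected U"
    and low: "\<And>l. l \<in> U \<Longrightarrow> \<exists>r>0. \<exists>c>0. \<forall>m\<in>ball l r. \<forall>u\<in>common_kernel fs.
      c * norm u \<le> norm (B u + m *\<^sub>C R u)"
    and l0: "l0 \<in> U" "boundedly_invertible (\<lambda>u. B u + l0 *\<^sub>C R u)"
  shows "countable {l \<in> U. \<not> boundedly_invertible (\<lambda>u. B u + l *\<^sub>C R u)}"
    and "l \<in> U \<Longrightarrow> \<exists>G. boundedly_invertible G \<and> finite_rank_diff G (\<lambda>u. B u + l *\<^sub>C R u)"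
proof -
  define I where "I = {l. boundedly_invertible (\<lambda>u. B u + l *\<^sub>C R u)}"
  have key: "\<exists>V. open V \<and> l \<in> V \<and> countable (V - I) \<and>
      (\<exists>G. boundedly_invertible G \<and> finite_rank_diff G (\<lambda>u. B u + l *\<^sub>C R u))"
    if l: "l \<in> U" "l \<in> closure I" for l
  proof -
    obtain r c where rc: "r > 0" "c > 0"
      "\<forall>m\<in>ball l r. \<forall>u\<in>common_kernel fs. c * norm u \<le> norm (B u + m *\<^sub>C R u)"
      using low[OF l(1)] by (elim exE conjE) (rule that)
    obtain \<eta> where \<eta>: "\<eta> > 0" and near:
      "\<forall>B. boundedly_invertible B \<longrightarrow> (\<forall>u\<in>common_kernel fs. c * norm u \<le> norm (B u)) \<longrightarrow>
      countable {l \<in> ball 0 \<eta>. \<not> boundedly_invertible (\<lambda>u. B u + l *\<^sub>C R u)} \<and>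
      (\<forall>l\<in>ball 0 \<eta>. \<exists>G. boundedly_invertible G \<and> finite_rank_diff G (\<lambda>u. B u + l *\<^sub>C R u))"
      using invertible_off_countable_near_invertible[OF R fs rc(2)]
      by (elim exE conjE) (rule that)
    obtain m where m: "m \<in> I" "dist m l < min r \<eta>"
      using l(2) rc(1) \<eta> unfolding closure_approachable by (metis min_less_iff_conj)
    have inv_m: "boundedly_invertible (\<lambda>u. B u + m *\<^sub>C R u)"
      using m unfolding I_def by simp
    have low_m: "\<forall>u\<in>common_kernel fs. c * norm u \<le> norm (B u + m *\<^sub>C R u)"
      using m by (intro bspec[OF rc(3)]) (simp add: dist_commute)
    note nr = near[rule_format, OF inv_m low_m[rule_format]]
    have eq: "B u + m *\<^sub>C R u + (k - m) *\<^sub>C R u = B u + k *\<^sub>C R u" for u k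
      by (simp add: complex_vector.scale_left_diff_distrib)
    have "ball m \<eta> - I = (\<lambda>k. m + k) ` {l \<in> ball 0 \<eta>. \<not> boundedly_invertible (\<lambda>u. B u + m *\<^sub>C R u + l *\<^sub>C R u)}"
    proof (intro equalityI subsetI)
      fix k assume "k \<in> ball m \<eta> - I"
      then have "k - m \<in> {l \<in> ball 0 \<eta>. \<not> boundedly_invertible (\<lambda>u. B u + m *\<^sub>C R u + l *\<^sub>C R u)}"
        by (auto simp: eq I_def dist_norm norm_minus_commute)
      then show "k \<in> (\<lambda>k. m + k) ` {l \<in> ball 0 \<eta>. \<not> boundedly_invertible (\<lambda>u. B u + m *\<^sub>C R u + l *\<^sub>C R u)}"
        by (rule rev_image_eqI) simp
    next
      fix k assume "k \<in> (\<lambda>k. m + k) ` {l \<in> ball 0 \<eta>. \<not> boundedly_invertible (\<lambda>u. B u + m *\<^sub>C R u + l *\<^sub>C R u)}"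
      then obtain j where j: "k = m + j" "j \<in> ball 0 \<eta>"
        "\<not> boundedly_invertible (\<lambda>u. B u + m *\<^sub>C R u + j *\<^sub>C R u)"
        by (elim imageE CollectE conjE) (rule that)
      have "B u + m *\<^sub>C R u + j *\<^sub>C R u = B u + k *\<^sub>C R u" for u
        unfolding j(1) by (simp add: scaleC_add_left)
      with j(3) have "\<not> boundedly_invertible (\<lambda>u. B u + k *\<^sub>C R u)"
        by simp
      then show "k \<in> ball m \<eta> - I"
        using j(1,2) unfolding I_def by (simp add: dist_norm)
    qed
    then have "countable (ball m \<eta> - I)" using nr by simp
    moreover have "l - m \<in> ball 0 \<eta>" "l \<in> ball m \<eta>"
      using m by (auto simp: dist_norm norm_minus_commute)
    moreover have "\<exists>G. boundedly_invertible G \<and> finite_rank_diff G (\<lambda>u. B u + l *\<^sub>C R u)"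
      using bspec[OF conjunct2[OF nr] \<open>l - m \<in> ball 0 \<eta>\<close>] unfolding eq .
    ultimately show ?thesis
      using open_ball by blast
  qed
  define V where "V = {l \<in> U. \<exists>W. open W \<and> l \<in> W \<and> countable (W - I)}"
  have closure_I: "l \<in> closure I" if "l \<in> closure V" for l
    unfolding closure_approachable
  proof (intro allI impI)
    fix e :: real assume "e > 0"
    with that obtain k where k: "k \<in> V" "dist k l < e"
      unfolding closure_approachable by blast
    then obtain W where W: "open W" "k \<in> W" "countable (W - I)" by (auto simp: V_def)
    have "open (W \<inter> ball l e)" "k \<in> W \<inter> ball l e"
      using W k by (auto simp: dist_commute)
    then obtain d where "d > 0" "ball k d \<subseteq> W \<inter> ball l e"
      by (meson openE)
    then have "uncountable (W \<inter> ball l e)"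
      using uncountable_ball countable_subset by blast
    then have "\<not> W \<inter> ball l e \<subseteq> W - I"
      using W(3) countable_subset by blast
    then show "\<exists>y\<in>I. dist y l < e" by (auto simp: dist_commute)
  qed
  have "openin (top_of_set U) V"
    unfolding openin_open
  proof (intro exI conjI)
    show "open (\<Union>{W. open W \<and> countable (W - I)})" by auto
    show "V = U \<inter> \<Union>{W. open W \<and> countable (W - I)}" by (auto simp: V_def)
  qed
  moreover have "closedin (top_of_set U) V"
    unfolding closedin_closed
  proof (intro exI conjI)
    show "V = U \<inter> closure V"
      using key[OF _ closure_I] closure_subset[of V] by (auto simp: V_def)
  qed simp
  moreover have "l0 \<in> closure I"
    using l0 closure_subset[of I] by (auto simp: I_def)
  then have "l0 \<in> V"
    using key[OF l0(1)] l0(1) by (auto simp: V_def)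
  ultimately have "V = U"
    using U(2) unfolding connected_clopen by blast
  then show "l \<in> U \<Longrightarrow> \<exists>G. boundedly_invertible G \<and> finite_rank_diff G (\<lambda>u. B u + l *\<^sub>C R u)"
    using key[OF _ closure_I] closure_subset[of V] by blast
  obtain \<F> where \<F>: "\<F> \<subseteq> {W. open W \<and> countable (W - I)}" "countable \<F>"
    "\<Union>\<F> = \<Union>{W. open W \<and> countable (W - I)}"
    using Lindelof[of "{W. open W \<and> countable (W - I)}"] by auto
  have "{l \<in> U. \<not> boundedly_invertible (\<lambda>u. B u + l *\<^sub>C R u)} \<subseteq> (\<Union>W\<in>\<F>. W - I)"
  proof
    fix l assume l: "l \<in> {l \<in> U. \<not> boundedly_invertible (\<lambda>u. B u + l *\<^sub>C R u)}"
    then have "l \<in> \<Union>\<F>" unfolding \<F>(3) using \<open>V = U\<close> by (auto simp: V_def)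
    with l show "l \<in> (\<Union>W\<in>\<F>. W - I)" by (auto simp: I_def)
  qed
  moreover have "countable (\<Union>W\<in>\<F>. W - I)"
    using \<F> by (intro countable_UN) auto
  ultimately show "countable {l \<in> U. \<not> boundedly_invertible (\<lambda>u. B u + l *\<^sub>C R u)}"
    by (rule countable_subset)
qed

section \<open>Strongly continuous semigroups\<close>

lemma C0_semigroupD:
  assumes "C0_semigroup T"
  shows "0 \<le> t \<Longrightarrow> bounded_clinear (T t)" "T 0 x = x"
    "0 \<le> s \<Longrightarrow> 0 \<le> t \<Longrightarrow> T (s + t) x = T s (T t x)"
    "continuous_on {0..} (\<lambda>t. T t x)"
  using assms by (auto simp: C0_semigroup_def)

text \<open>The uniform boundedness principle, obtained from the Baire category theorem.\<close>

lemma C0_semigroup_bounded_on_interval: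
  fixes T :: "real \<Rightarrow> 'a::complex_banach \<Rightarrow> 'a"
  assumes T: "C0_semigroup T"
  obtains N where "N > 0" "\<And>t x. 0 \<le> t \<Longrightarrow> t \<le> t0 \<Longrightarrow> norm (T t x) \<le> N * norm x"
proof -
  define F where "F n = {x. \<forall>t\<in>{0..t0}. norm (T t x) \<le> real n}" for n :: nat
  have "closed (F n)" for n
  proof -
    have "F n = (\<Inter>t\<in>{0..t0}. {x. norm (T t x) \<le> real n})" by (auto simp: F_def)
    moreover have "closed {x. norm (T t x) \<le> real n}" if "t \<in> {0..t0}" for t
      using that C0_semigroupD(1)[OF T, of t]
      by (intro closed_Collect_le continuous_intros linear_continuous_on bounded_clinear_imp_bounded_linear) auto
    ultimately show ?thesis by auto
  qed
  moreover have "\<Union> (range F) = UNIV"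
  proof -
    have "x \<in> \<Union> (range F)" for x
    proof -
      have "compact ((\<lambda>t. T t x) ` {0..t0})"
        using C0_semigroupD(4)[OF T, of x]
        by (intro compact_continuous_image compact_Icc) (auto elim: continuous_on_subset)
      then obtain b where b: "\<And>t. t \<in> {0..t0} \<Longrightarrow> norm (T t x) \<le> b"
        using compact_imp_bounded bounded_iff by (metis imageI)
      have "x \<in> F (nat \<lceil>b\<rceil>)"
        using order_trans[OF b real_nat_ceiling_ge] by (simp add: F_def)
      then show ?thesis by blast
    qed
    then show ?thesis by blast
  qed
  ultimately have "\<exists>n. interior (F n) \<noteq> {}"
    using Met_TC.metric_Baire_category_alt[of "range F"] complete_UNIV by fastforce
  then obtain n x0 where "x0 \<in> interior (F n)" by blast
  then obtain r where r: "r > 0" "cball x0 r \<subseteq> F n"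
    by (meson mem_interior_cball)
  show thesis
  proof
    show "2 * real n / r + 1 > 0" using r(1) by (simp add: add_nonneg_pos)
    fix t x assume t: "0 \<le> t" "t \<le> t0"
    note Ts = bounded_clinear_simps[OF C0_semigroupD(1)[OF T t(1)]]
    have lin: "T t (a *\<^sub>R x) = a *\<^sub>R T t x" for a
      using Ts(5)[of "complex_of_real a" x] by (simp add: scaleC_of_real)
    show "norm (T t x) \<le> (2 * real n / r + 1) * norm x"
    proof (cases "x = 0")
      case False
      define y where "y = (r / norm x) *\<^sub>R x"
      have "x0 + y \<in> cball x0 r" "x0 \<in> cball x0 r"
        using r(1) False by (auto simp: y_def dist_norm)
      then have "x0 + y \<in> F n" "x0 \<in> F n"
        using r(2) by blast+
      then have "norm (T t (x0 + y)) \<le> n" "norm (T t x0) \<le> n"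
        using t by (auto simp: F_def)
      then have "norm (T t y) \<le> 2 * real n"
        using norm_triangle_ineq4[of "T t (x0 + y)" "T t x0"] by (simp add: Ts)
      then have "r / norm x * norm (T t x) \<le> 2 * real n"
        using r(1) by (simp add: y_def lin)
      then have "norm (T t x) \<le> 2 * real n / r * norm x"
        using r(1) False by (simp add: field_simps)
      then show ?thesis unfolding distrib_right using norm_ge_zero[of x] by linarith
    qed (simp add: Ts)
  qed
qed

lemma tendsto_integral_average:
  fixes g :: "real \<Rightarrow> 'a::banach"
  assumes g: "continuous_on {a..} g"
  shows "((\<lambda>h. integral {a..a + h} g /\<^sub>R h) \<longlongrightarrow> g a) (at_right 0)"
proof (rule tendstoI)
  fix e :: real assume "e > 0"
  then obtain d where d: "d > 0" "\<And>s. s \<in> {a..} \<Longrightarrow> dist s a < d \<Longrightarrow> dist (g s) (g a) < e / 2"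
    using g unfolding continuous_on_iff by (metis atLeast_iff half_gt_zero order_refl)
  have "dist (integral {a..a + h} g /\<^sub>R h) (g a) < e" if h: "0 < h" "h < d" for h
  proof -
    have int: "g integrable_on {a..a + h}"
      by (intro integrable_continuous_real continuous_on_subset[OF g]) auto
    have "norm (integral {a..a + h} (\<lambda>s. g s - g a)) \<le> e / 2 * (a + h - a)"
    proof (rule integral_bound)
      show "continuous_on {a..a + h} (\<lambda>s. g s - g a)"
        by (intro continuous_intros continuous_on_subset[OF g]) auto
      show "norm (g s - g a) \<le> e / 2" if "s \<in> {a..a + h}" for s
        using d(2)[of s] that h by (auto simp: dist_norm)
    qed (use h in auto)
    also have "integral {a..a + h} (\<lambda>s. g s - g a) = integral {a..a + h} g - h *\<^sub>R g a"
      using int h by (subst integral_diff) auto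
    finally have le: "norm (integral {a..a + h} g - h *\<^sub>R g a) \<le> e / 2 * h" by simp
    have eq: "integral {a..a + h} g /\<^sub>R h - g a = (integral {a..a + h} g - h *\<^sub>R g a) /\<^sub>R h"
      using h by (simp add: scaleR_diff_right)
    have "dist (integral {a..a + h} g /\<^sub>R h) (g a) = norm (integral {a..a + h} g - h *\<^sub>R g a) / h"
      unfolding dist_norm eq using h by (simp add: divide_inverse mult.commute)
    also have "\<dots> \<le> e / 2"
      using le h by (simp add: pos_divide_le_eq)
    finally show ?thesis using \<open>e > 0\<close> by simp
  qed
  then show "\<forall>\<^sub>F h in at_right 0. dist (integral {a..a + h} g /\<^sub>R h) (g a) < e"
    using d(1) unfolding eventually_at_right_field by blast
qed

lemma tendsto_exp_difference_quotient:
  "((\<lambda>h. (exp (l * complex_of_real h) - 1) / complex_of_real h) \<longlongrightarrow> l) (at_right 0)"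
proof -
  have "((\<lambda>z. exp (l * z)) has_field_derivative l) (at 0)"
    by (auto intro!: derivative_eq_intros)
  then have "((\<lambda>z. (exp (l * z) - 1) / z) \<longlongrightarrow> l) (at 0)"
    by (simp add: has_field_derivative_iff)
  moreover have "filterlim complex_of_real (at 0) (at_right 0)"
    by (auto intro!: filterlim_atI tendsto_eq_intros simp: eventually_at_filter)
  ultimately show ?thesis
    by (rule filterlim_compose)
qed

text \<open>A substitute for the resolvent that exists for every \<open>l\<close>: on both sides it inverts \<open>l - A\<close>
  up to the term \<open>exp (- l t) T(t)\<close>, see \<open>truncated_laplace_right_inverse\<close> and \<open>truncated_laplace_left_inverse\<close>.\<close>

definition truncated_laplace :: "(real \<Rightarrow> 'a::complex_banach \<Rightarrow> 'a) \<Rightarrow> complex \<Rightarrow> real \<Rightarrow> 'a \<Rightarrow> 'a" where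
  "truncated_laplace T l t x = integral {0..t} (\<lambda>s. exp (- l * complex_of_real s) *\<^sub>C T s x)"

lemma continuous_on_laplace_integrand:
  assumes "C0_semigroup T"
  shows "continuous_on {0..} (\<lambda>s. exp (- l * complex_of_real s) *\<^sub>C T s x)"
  by (intro continuous_intros C0_semigroupD(4)[OF assms])

lemma integrable_laplace_integrand:
  fixes T :: "real \<Rightarrow> 'a::complex_banach \<Rightarrow> 'a"
  assumes "C0_semigroup T"
  shows "(\<lambda>s. exp (- l * complex_of_real s) *\<^sub>C T s x) integrable_on {0..t}"
  by (intro integrable_continuous_real continuous_on_subset[OF continuous_on_laplace_integrand[OF assms]])
    auto

lemma truncated_laplace_bound:
  assumes T: "C0_semigroup T" and t: "0 \<le> t"
    and N: "\<And>s x. 0 \<le> s \<Longrightarrow> s \<le> t \<Longrightarrow> norm (T s x) \<le> N * norm x"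
    and E: "\<And>s. 0 \<le> s \<Longrightarrow> s \<le> t \<Longrightarrow> exp (- Re l * s) \<le> E"
  shows "norm (truncated_laplace T l t x) \<le> E * N * t * norm x"
proof -
  have "norm (truncated_laplace T l t x) \<le> (E * (N * norm x)) * (t - 0)"
    unfolding truncated_laplace_def
  proof (rule integral_bound[OF t])
    show "continuous_on {0..t} (\<lambda>s. exp (- l * complex_of_real s) *\<^sub>C T s x)"
      by (rule continuous_on_subset[OF continuous_on_laplace_integrand[OF T]]) auto
    fix s assume s: "s \<in> {0..t}"
    then show "norm (exp (- l * complex_of_real s) *\<^sub>C T s x) \<le> E * (N * norm x)"
      using N[of s x] E[of s] by (auto simp: norm_scaleC norm_exp_eq_Re intro!: mult_mono' order_trans[OF _ E])
  qed
  then show ?thesis by (simp add: ac_simps)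
qed

lemma bounded_clinear_truncated_laplace:
  fixes T :: "real \<Rightarrow> 'a::complex_banach \<Rightarrow> 'a"
  assumes T: "C0_semigroup T" and t: "0 \<le> t"
  shows "bounded_clinear (truncated_laplace T l t)"
proof -
  note int = integrable_laplace_integrand[OF T]
  obtain N where N: "N > 0" "\<And>s x. 0 \<le> s \<Longrightarrow> s \<le> t \<Longrightarrow> norm (T s x) \<le> N * norm x"
    using C0_semigroup_bounded_on_interval[OF T] by metis
  have sc: "truncated_laplace T l t (c *\<^sub>C x) = c *\<^sub>C truncated_laplace T l t x" for c x
  proof -
    have "truncated_laplace T l t (c *\<^sub>C x)
        = integral {0..t} (scaleC c \<circ> (\<lambda>s. exp (- l * complex_of_real s) *\<^sub>C T s x))"
      unfolding truncated_laplace_def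
      by (intro integral_cong)
        (simp add: bounded_clinear_scaleC[OF C0_semigroupD(1)[OF T]] scaleC_scaleC mult.commute)
    also have "\<dots> = c *\<^sub>C truncated_laplace T l t x"
      unfolding truncated_laplace_def by (rule integral_linear[OF int scaleC_right_bounded_linear])
    finally show ?thesis .
  qed
  have "bounded_linear (truncated_laplace T l t)"
  proof (rule bounded_linear_intro)
    show "truncated_laplace T l t (x + y) = truncated_laplace T l t x + truncated_laplace T l t y" for x y
      unfolding truncated_laplace_def
      by (subst integral_add[OF int int, symmetric], intro integral_cong)
        (simp add: bounded_clinear_simps[OF C0_semigroupD(1)[OF T]] scaleC_add_right)
    show "truncated_laplace T l t (r *\<^sub>R x) = r *\<^sub>R truncated_laplace T l t x" for r x
      using sc[of "complex_of_real r" x] by (simp add: scaleC_of_real)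
    have "exp (- Re l * s) \<le> exp (\<bar>Re l\<bar> * t)" if "0 \<le> s" "s \<le> t" for s
    proof -
      have "- Re l * s \<le> \<bar>Re l\<bar> * s" using that by (intro mult_right_mono) auto
      also have "\<dots> \<le> \<bar>Re l\<bar> * t" using that by (intro mult_left_mono) auto
      finally show ?thesis by simp
    qed
    from truncated_laplace_bound[OF T t N(2) this]
    show "norm (truncated_laplace T l t x) \<le> norm x * (exp (\<bar>Re l\<bar> * t) * N * t)" for x
      by (simp add: ac_simps)
  qed
  with sc show ?thesis by (simp add: bounded_clinear_def)
qed

lemma truncated_laplace_commute:
  assumes T: "C0_semigroup T" and h: "0 \<le> h"
  shows "T h (truncated_laplace T l t x) = truncated_laplace T l t (T h x)"
proof -
  have "T h (truncated_laplace T l t x)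
      = integral {0..t} (T h \<circ> (\<lambda>s. exp (- l * complex_of_real s) *\<^sub>C T s x))"
    unfolding truncated_laplace_def
    by (rule integral_linear[OF integrable_laplace_integrand[OF T], symmetric])
      (rule bounded_clinear_imp_bounded_linear[OF C0_semigroupD(1)[OF T h]])
  also have "\<dots> = truncated_laplace T l t (T h x)"
    unfolding truncated_laplace_def
    using C0_semigroupD(3)[OF T h, of _ x] C0_semigroupD(3)[OF T _ h, of _ x]
    by (intro integral_cong) (simp add: bounded_clinear_scaleC[OF C0_semigroupD(1)[OF T h]] add.commute)
  finally show ?thesis .
qed

text \<open>With \<open>g\<close> the integrand, \<open>T(h) J x\<close> equals \<open>exp (l h)\<close> times the integral of \<open>g\<close> over \<open>[h, t + h]\<close>,
  and the derivative at \<open>h = 0\<close> follows from the product rule.\<close>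

lemma truncated_laplace_derivative:
  fixes T :: "real \<Rightarrow> 'a::complex_banach \<Rightarrow> 'a" and l :: complex
  assumes T: "C0_semigroup T" and t: "0 \<le> t"
  defines "J \<equiv> truncated_laplace T l t"
  shows "((\<lambda>h. (T h (J x) - J x) /\<^sub>R h) \<longlongrightarrow>
    l *\<^sub>C J x + exp (- l * complex_of_real t) *\<^sub>C T t x - x) (at_right 0)"
proof -
  define g where "g s = exp (- l * complex_of_real s) *\<^sub>C T s x" for s
  have g: "continuous_on {0..} g"
    unfolding g_def by (rule continuous_on_laplace_integrand[OF T])
  then have gt: "continuous_on {t..} g"
    using t by (auto elim: continuous_on_subset)
  have int: "g integrable_on {a..b}" if "0 \<le> a" for a b
    by (intro integrable_continuous_real continuous_on_subset[OF g]) (use that in auto)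
  have "(T h (J x) - J x) /\<^sub>R h = ((exp (l * complex_of_real h) - 1) / complex_of_real h) *\<^sub>C J x
      + exp (l * complex_of_real h) *\<^sub>C (integral {t..t + h} g /\<^sub>R h - integral {0..0 + h} g /\<^sub>R h)"
    if h: "0 < h" for h
  proof -
    have "T h (J x) = integral {0..t} (T h \<circ> g)"
      unfolding J_def truncated_laplace_def g_def using h
      by (intro integral_linear[OF integrable_laplace_integrand[OF T], symmetric])
        (simp add: bounded_clinear_imp_bounded_linear C0_semigroupD(1)[OF T])
    also have "\<dots> = integral {0..t} (scaleC (exp (l * complex_of_real h)) \<circ> (g \<circ> (+) h))"
      unfolding g_def using h C0_semigroupD(3)[OF T, of h _ x]
      by (intro integral_cong)
        (simp add: bounded_clinear_scaleC[OF C0_semigroupD(1)[OF T]] scaleC_scaleC ring_distribs flip: exp_add)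
    also have "\<dots> = exp (l * complex_of_real h) *\<^sub>C integral {0..t} (g \<circ> (+) h)"
    proof (rule integral_linear[OF _ scaleC_right_bounded_linear])
      show "g \<circ> (+) h integrable_on {0..t}"
        using h by (intro integrable_continuous_real continuous_on_compose continuous_intros
            continuous_on_subset[OF g]) auto
    qed
    also have "integral {0..t} (g \<circ> (+) h) = integral {h..t + h} g"
      using integral_shift_cbox[of h h "t + h" g] by (simp add: add.commute comp_def)
    also have "\<dots> = J x + (integral {t..t + h} g - integral {0..0 + h} g)"
      using Henstock_Kurzweil_Integration.integral_combine[where a = 0 and c = h and b = "t + h" and f = g]
        Henstock_Kurzweil_Integration.integral_combine[where a = 0 and c = t and b = "t + h" and f = g] h t int[of 0 "t + h"]
      by (simp add: J_def truncated_laplace_def g_def[abs_def] algebra_simps)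
    finally have eq: "T h (J x) - J x = (exp (l * complex_of_real h) - 1) *\<^sub>C J x
        + exp (l * complex_of_real h) *\<^sub>C (integral {t..t + h} g - integral {0..0 + h} g)"
      by (simp add: scaleC_add_right complex_vector.scale_left_diff_distrib)
    have div: "y /\<^sub>R h = (1 / complex_of_real h) *\<^sub>C y" for y :: 'a
      using scaleC_of_real[of "inverse h" y] by (simp add: divide_inverse)
    show ?thesis
      unfolding eq div
      by (simp add: scaleC_add_right scaleC_scaleC complex_vector.scale_right_diff_distrib mult.commute)
  qed
  then have ev: "\<forall>\<^sub>F h in at_right 0.
      ((exp (l * complex_of_real h) - 1) / complex_of_real h) *\<^sub>C J x
      + exp (l * complex_of_real h) *\<^sub>C (integral {t..t + h} g /\<^sub>R h - integral {0..0 + h} g /\<^sub>R h)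
      = (T h (J x) - J x) /\<^sub>R h"
    by (auto simp: eventually_at_filter)
  have lim: "((\<lambda>h. ((exp (l * complex_of_real h) - 1) / complex_of_real h) *\<^sub>C J x
      + exp (l * complex_of_real h) *\<^sub>C (integral {t..t + h} g /\<^sub>R h - integral {0..0 + h} g /\<^sub>R h))
      \<longlongrightarrow> l *\<^sub>C J x + exp (l * complex_of_real 0) *\<^sub>C (g t - g 0)) (at_right 0)"
    by (intro tendsto_intros tendsto_scaleC tendsto_exp_difference_quotient
        tendsto_integral_average[OF g] tendsto_integral_average[OF gt])
  have eq: "l *\<^sub>C J x + exp (l * complex_of_real 0) *\<^sub>C (g t - g 0)
      = l *\<^sub>C J x + exp (- l * complex_of_real t) *\<^sub>C T t x - x"
    by (simp add: g_def C0_semigroupD(2)[OF T])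
  show ?thesis
    by (rule Lim_transform_eventually[OF lim[unfolded eq] ev])
qed

lemma generator_domI:
  assumes "((\<lambda>h. (T h x - x) /\<^sub>R h) \<longlongrightarrow> y) (at_right 0)"
  shows "x \<in> opdom (generator T)" "opfun (generator T) x = y"
  using assms tendsto_Lim[OF _ assms] by (auto simp: generator_def)

lemma generator_tendsto:
  assumes "x \<in> opdom (generator T)"
  shows "((\<lambda>h. (T h x - x) /\<^sub>R h) \<longlongrightarrow> opfun (generator T) x) (at_right 0)"
  using assms generator_domI(2)[of T x] by (auto simp: generator_def)

lemma truncated_laplace_right_inverse:
  fixes T :: "real \<Rightarrow> 'a::complex_banach \<Rightarrow> 'a"
  assumes T: "C0_semigroup T" and t: "0 \<le> t"
  shows "truncated_laplace T l t x \<in> opdom (generator T)"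
    and "shifted l (generator T) (truncated_laplace T l t x) = x - exp (- l * complex_of_real t) *\<^sub>C T t x"
  using generator_domI[where T = T and x = "truncated_laplace T l t x", OF truncated_laplace_derivative[OF T t]]
  by (simp_all add: shifted_def)

text \<open>Since \<open>J\<close> is bounded and commutes with the semigroup, the derivative of \<open>T(h) J x\<close> at \<open>h = 0\<close> is also
  \<open>J A x\<close> when \<open>x\<close> is in the domain of the generator \<open>A\<close>.\<close>

lemma truncated_laplace_left_inverse:
  fixes T :: "real \<Rightarrow> 'a::complex_banach \<Rightarrow> 'a"
  assumes T: "C0_semigroup T" and t: "0 \<le> t" and x: "x \<in> opdom (generator T)"
  shows "truncated_laplace T l t (shifted l (generator T) x) = x - exp (- l * complex_of_real t) *\<^sub>C T t x"
proof -
  define J where "J = truncated_laplace T l t"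
  have J: "bounded_clinear J"
    unfolding J_def by (rule bounded_clinear_truncated_laplace[OF T t])
  have "((\<lambda>h. J ((T h x - x) /\<^sub>R h)) \<longlongrightarrow> J (opfun (generator T) x)) (at_right 0)"
    by (rule bounded_linear.tendsto[OF bounded_clinear_imp_bounded_linear[OF J] generator_tendsto[OF x]])
  moreover have "\<forall>\<^sub>F h in at_right 0. J ((T h x - x) /\<^sub>R h) = (T h (J x) - J x) /\<^sub>R h"
    using truncated_laplace_commute[OF T, of _ l t x]
    by (auto simp: eventually_at_filter J_def[symmetric] bounded_clinear_simps[OF J]
        linear_simps[OF bounded_clinear_imp_bounded_linear[OF J]])
  ultimately have "((\<lambda>h. (T h (J x) - J x) /\<^sub>R h) \<longlongrightarrow> J (opfun (generator T) x)) (at_right 0)"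
    by (rule Lim_transform_eventually)
  then have "J (opfun (generator T) x) = l *\<^sub>C J x + exp (- l * complex_of_real t) *\<^sub>C T t x - x"
    using truncated_laplace_derivative[OF T t, of l x] unfolding J_def
    by (intro tendsto_unique[OF trivial_limit_at_right_real])
  then show ?thesis
    by (simp add: shifted_def bounded_clinear_simps[OF J] flip: J_def)
qed

section \<open>Fredholm operators with invertible finite rank perturbations\<close>

text \<open>For \<open>v\<close> outside \<open>Z\<close>, the coefficient of \<open>v\<close> in \<open>y + a v\<close> is controlled by the norm, because \<open>v\<close> has
  positive distance from \<open>Z\<close>.\<close>

lemma closed_add_line:
  fixes Z :: "'a::complex_normed_vector set"
  assumes Z: "complex_vector.subspace Z" "closed Z"
  shows "closed {y + a *\<^sub>C v | y a. y \<in> Z}"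
proof (cases "v \<in> Z")
  case True
  have "{y + a *\<^sub>C v | y a. y \<in> Z} = Z"
  proof (intro equalityI subsetI)
    fix x assume "x \<in> Z"
    then show "x \<in> {y + a *\<^sub>C v | y a. y \<in> Z}"
      by (intro CollectI exI[of _ x] exI[of _ 0]) simp
  qed (use True Z(1) in \<open>auto intro: complex_vector.subspace_add complex_vector.subspace_scale\<close>)
  with Z(2) show ?thesis by simp
next
  case False
  have "Z \<noteq> {}" using Z(1) complex_vector.subspace_0 by blast
  define d where "d = infdist v Z"
  have d: "d > 0"
    unfolding d_def by (rule infdist_pos_not_in_closed[OF Z(2) \<open>Z \<noteq> {}\<close> False])
  have dist: "norm a * d \<le> norm (y + a *\<^sub>C v)" if y: "y \<in> Z" for y a
  proof (cases "a = 0")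
    case False
    have "(- (1 / a)) *\<^sub>C y \<in> Z"
      using Z(1) y by (rule complex_vector.subspace_scale)
    then have "d \<le> norm (v - (- (1 / a)) *\<^sub>C y)"
      unfolding d_def dist_norm[symmetric] by (rule infdist_le)
    then have "norm a * d \<le> norm (a *\<^sub>C (v - (- (1 / a)) *\<^sub>C y))"
      by (simp add: norm_scaleC mult_left_mono)
    also have "a *\<^sub>C (v - (- (1 / a)) *\<^sub>C y) = y + a *\<^sub>C v"
      using False by (simp add: scaleC_add_right scaleC_scaleC complex_vector.scale_right_diff_distrib)
    finally show ?thesis .
  qed simp
  show ?thesis
    unfolding closed_sequential_limits
  proof (intro allI impI, elim conjE)
    fix s x assume "\<forall>n. s n \<in> {y + a *\<^sub>C v | y a. y \<in> Z}" and lim: "s \<longlonglongrightarrow> x"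
    then have "\<forall>n. \<exists>y a. s n = y + a *\<^sub>C v \<and> y \<in> Z" by blast
    then obtain y a where ya: "\<And>n. s n = y n + a n *\<^sub>C v" "\<And>n. y n \<in> Z"
      by metis
    have "Cauchy a"
      unfolding Cauchy_altdef2
    proof (intro allI impI)
      fix e :: real assume "e > 0"
      then obtain k where k: "\<And>n. n \<ge> k \<Longrightarrow> dist (s n) (s k) < e * d"
        using LIMSEQ_imp_Cauchy[OF lim] d unfolding Cauchy_altdef2 by (metis mult_pos_pos)
      have "dist (a n) (a k) < e" if "n \<ge> k" for n
      proof -
        have "norm (a n - a k) * d \<le> norm ((y n - y k) + (a n - a k) *\<^sub>C v)"
          by (intro dist complex_vector.subspace_diff Z ya)
        also have "(y n - y k) + (a n - a k) *\<^sub>C v = s n - s k"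
          by (simp add: ya complex_vector.scale_left_diff_distrib)
        also have "norm (s n - s k) < e * d"
          using k[OF that] by (simp add: dist_norm)
        finally show ?thesis using d by (simp add: dist_norm)
      qed
      then show "\<exists>k. \<forall>n\<ge>k. dist (a n) (a k) < e" by blast
    qed
    then obtain a' where a': "a \<longlonglongrightarrow> a'"
      using Cauchy_convergent convergent_def by blast
    have "(\<lambda>n. s n - a n *\<^sub>C v) \<longlonglongrightarrow> x - a' *\<^sub>C v"
      by (intro tendsto_diff lim tendsto_scaleC a' tendsto_const)
    then have "y \<longlonglongrightarrow> x - a' *\<^sub>C v" by (simp add: ya)
    then have "x - a' *\<^sub>C v \<in> Z"
      using Z(2) ya(2) closed_sequentially by blast
    then show "x \<in> {y + a *\<^sub>C v | y a. y \<in> Z}"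
      by (intro CollectI exI[of _ "x - a' *\<^sub>C v"] exI[of _ a']) simp
  qed
qed

lemma closed_common_kernel:
  assumes "\<And>f. f \<in> set fs \<Longrightarrow> bounded_clinear f"
  shows "closed (common_kernel fs)"
proof -
  have "common_kernel fs = (\<Inter>f\<in>set fs. {u. f u = 0})"
    by (auto simp: common_kernel_def)
  moreover have "closed {u. f u = 0}" if "f \<in> set fs" for f
    by (intro closed_Collect_eq continuous_on_const linear_continuous_on
        bounded_clinear_imp_bounded_linear assms that)
  ultimately show ?thesis by auto
qed

lemma complex_subspace_imp_subspace:
  assumes "complex_vector.subspace S"
  shows "subspace S"
proof (rule subspaceI)
  show "r *\<^sub>R x \<in> S" if "x \<in> S" for r x
    using complex_vector.subspace_scale[OF assms that, of "complex_of_real r"] by (simp add: scaleC_of_real)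
qed (use assms in \<open>auto intro: complex_vector.subspace_0 complex_vector.subspace_add\<close>)

lemma complex_subspace_image:
  assumes "bounded_clinear K" "complex_vector.subspace N"
  shows "complex_vector.subspace (K ` N)"
proof (rule complex_vector.subspaceI)
  show "0 \<in> K ` N"
    using complex_vector.subspace_0[OF assms(2)] bounded_clinear_simps(3)[OF assms(1)]
    by (intro image_eqI[where x = 0]) simp_all
next
  fix x y assume "x \<in> K ` N" "y \<in> K ` N"
  then obtain u v where "x = K u" "u \<in> N" "y = K v" "v \<in> N" by blast
  then show "x + y \<in> K ` N"
    using complex_vector.subspace_add[OF assms(2)] bounded_clinear_simps(1)[OF assms(1)]
    by (intro image_eqI[where x = "u + v"]) simp_all
next
  fix c x assume "x \<in> K ` N"
  then obtain u where "x = K u" "u \<in> N" by blast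
  then show "c *\<^sub>C x \<in> K ` N"
    using complex_vector.subspace_scale[OF assms(2)] bounded_clinear_simps(5)[OF assms(1)]
    by (intro image_eqI[where x = "c *\<^sub>C u"]) simp_all
qed

text \<open>The image of the common kernel is closed by the lower bound, and the full range arises from it
  by adding finitely many lines.\<close>

lemma closed_range_of_lower_bound:
  fixes K :: "'a::complex_banach \<Rightarrow> 'a"
  assumes K: "bounded_clinear K" and fs: "\<forall>f\<in>set fs. bounded_clinear f"
    and c: "c > 0" "\<And>u. u \<in> common_kernel fs \<Longrightarrow> c * norm u \<le> norm (K u)"
  shows "closed (range K)"
proof -
  have "complete (K ` common_kernel fs)"
    by (rule complete_isometric_image[OF c(1) complex_subspace_imp_subspace[OF subspace_common_kernel[OF bspec[OF fs]]]
          bounded_clinear_imp_bounded_linear[OF K]])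
      (use c(2) closed_common_kernel[OF bspec[OF fs]] in \<open>auto simp: complete_eq_closed\<close>)
  then have "closed (K ` common_kernel fs)" by (simp add: complete_eq_closed)
  with fs show ?thesis
  proof (induction fs)
    case Nil
    then show ?case by simp
  next
    case (Cons f fs)
    have f: "bounded_clinear f" and fs: "\<forall>g\<in>set fs. bounded_clinear g"
      using Cons.prems by auto
    have "closed (K ` common_kernel fs)"
    proof (cases "\<exists>u\<in>common_kernel fs. f u \<noteq> 0")
      case False
      then have "common_kernel (f # fs) = common_kernel fs" by auto
      with Cons.prems show ?thesis by simp
    next
      case True
      then obtain z where z: "z \<in> common_kernel fs" "f z = 1"
        using common_kernel_normalized_vector[OF f bspec[OF fs]] by metis
      note sub = subspace_common_kernel[OF bspec[OF fs]]
      have eq: "K ` common_kernel fs = {y + a *\<^sub>C K z | y a. y \<in> K ` common_kernel (f # fs)}"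
      proof (intro equalityI subsetI)
        fix y assume "y \<in> K ` common_kernel fs"
        then obtain u where u: "y = K u" "u \<in> common_kernel fs" by blast
        have "u - f u *\<^sub>C z \<in> common_kernel (f # fs)"
          using u z sub
          by (simp add: bounded_clinear_simps[OF f] scaleC_complex_def complex_vector.subspace_diff
              complex_vector.subspace_scale)
        moreover have "y = K (u - f u *\<^sub>C z) + f u *\<^sub>C K z"
          by (simp add: u bounded_clinear_simps[OF K])
        ultimately show "y \<in> {y + a *\<^sub>C K z | y a. y \<in> K ` common_kernel (f # fs)}"
          by blast
      next
        fix y assume "y \<in> {y + a *\<^sub>C K z | y a. y \<in> K ` common_kernel (f # fs)}"
        then obtain u a where u: "y = K u + a *\<^sub>C K z" "u \<in> common_kernel (f # fs)" by blast
        then have "y = K (u + a *\<^sub>C z)" by (simp add: bounded_clinear_simps[OF K])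
        moreover have "u + a *\<^sub>C z \<in> common_kernel fs"
          using u z sub by (simp add: complex_vector.subspace_add complex_vector.subspace_scale)
        ultimately show "y \<in> K ` common_kernel fs" by blast
      qed
      have "complex_vector.subspace (K ` common_kernel (f # fs))"
        by (intro complex_subspace_image[OF K] subspace_common_kernel) (use Cons.prems in auto)
      then show ?thesis
        unfolding eq by (rule closed_add_line[OF _ Cons.prems(2)])
    qed
    then show ?case by (rule Cons.IH[OF fs])
  qed
qed

lemma finite_dimensional_kernel_of_finite_rank_diff:
  assumes G: "boundedly_invertible G" and "finite_rank_diff G K"
  shows "finite_dimensional {u. K u = 0}"
proof -
  obtain S where S: "finite S" "\<And>u. G u - K u \<in> complex_vector.span S"
    using assms(2) by (auto simp: finite_rank_diff_def)
  obtain c where "c > 0" "\<And>u. c * norm u \<le> norm (G u)"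
    using G by (auto simp: boundedly_invertible_def)
  then have inv: "bounded_clinear (inv G)"
    by (rule bounded_clinear_inv(1)[OF G])
  have span: "inv G y \<in> complex_vector.span (inv G ` S)" if "y \<in> complex_vector.span S" for y
    using that
  proof (induction rule: complex_vector.span_induct_alt)
    case base
    then show ?case by (simp add: bounded_clinear_simps[OF inv] complex_vector.span_zero)
  next
    case (step a x y)
    then show ?case
      by (simp add: bounded_clinear_simps[OF inv] complex_vector.span_add complex_vector.span_scale
          complex_vector.span_base)
  qed
  have "u \<in> complex_vector.span (inv G ` S)" if "K u = 0" for u
    using span[OF S(2)[of u]] that inv_f_f[OF bij_is_inj[OF boundedly_invertibleD(2)[OF G]]] by simp
  then show ?thesis
    unfolding finite_dimensional_def using S(1) by (intro exI[of _ "inv G ` S"]) auto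
qed

lemma finite_codimensional_range_of_finite_rank_diff:
  assumes G: "boundedly_invertible G" and "finite_rank_diff G K"
  shows "finite_codimensional (range K)"
proof -
  obtain S where S: "finite S" "\<And>u. G u - K u \<in> complex_vector.span S"
    using assms(2) by (auto simp: finite_rank_diff_def)
  have "y \<in> complex_vector.span (range K \<union> S)" for y
  proof -
    obtain u where u: "y = G u"
      using bij_is_surj[OF boundedly_invertibleD(2)[OF G]] by (metis surjD)
    have "G u - K u \<in> complex_vector.span (range K \<union> S)"
      using S(2)[of u] complex_vector.span_mono[of S "range K \<union> S"] by blast
    then have "K u + (G u - K u) \<in> complex_vector.span (range K \<union> S)"
      by (intro complex_vector.span_add complex_vector.span_base[of "K u"]) auto
    then show ?thesis by (simp add: u)
  qed
  then show ?thesis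
    unfolding finite_codimensional_def using S(1) by (intro exI[of _ S]) auto
qed

section \<open>Resolvents and the spectral bounds\<close>

lemma resolvent_setD:
  assumes "l0 \<in> resolvent_set A"
  shows "bounded_clinear (resolvent l0 A)" "resolvent l0 A u \<in> opdom A"
    "shifted l0 A (resolvent l0 A u) = u" "x \<in> opdom A \<Longrightarrow> resolvent l0 A (shifted l0 A x) = x"
proof -
  have bij: "bij_betw (shifted l0 A) (opdom A) UNIV"
    and "bounded_clinear (resolvent l0 A)"
    using assms by (auto simp: resolvent_set_def)
  then show "bounded_clinear (resolvent l0 A)" by simp
  have img: "u \<in> shifted l0 A ` opdom A"
    using bij by (simp add: bij_betw_def)
  show "resolvent l0 A u \<in> opdom A"
    unfolding resolvent_def by (rule inv_into_into[OF img])
  show "shifted l0 A (resolvent l0 A u) = u"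
    unfolding resolvent_def by (rule f_inv_into_f[OF img])
  show "x \<in> opdom A \<Longrightarrow> resolvent l0 A (shifted l0 A x) = x"
    unfolding resolvent_def using bij by (simp add: bij_betw_def)
qed

lemma resolvent_setI:
  assumes R: "bounded_clinear R" "\<And>u. R u \<in> opdom A" "\<And>u. shifted l A (R u) = u"
    "\<And>x. x \<in> opdom A \<Longrightarrow> R (shifted l A x) = x"
  shows "l \<in> resolvent_set A"
proof -
  have inj: "inj_on (shifted l A) (opdom A)"
    using R(4) by (metis inj_onI)
  have "shifted l A ` opdom A = UNIV"
    using R(2,3) by (metis UNIV_eq_I image_eqI)
  moreover have "resolvent l A = R"
    unfolding resolvent_def using inv_into_f_eq[OF inj R(2,3)] by auto
  ultimately show ?thesis
    using R(1) inj by (simp add: resolvent_set_def bij_betw_def)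
qed

lemma resolvent_norm_le:
  assumes l: "l \<in> resolvent_set A" and c: "c > 0" "\<And>x. x \<in> opdom A \<Longrightarrow> c * norm x \<le> norm (shifted l A x)"
  shows "resolvent_norm l A \<le> ereal (1 / c)"
proof -
  have "onorm (resolvent l A) \<le> 1 / c"
  proof (rule onorm_bound)
    fix u
    show "norm (resolvent l A u) \<le> 1 / c * norm u"
      using c(2)[OF resolvent_setD(2)[OF l, of u]] c(1) resolvent_setD(3)[OF l]
      by (simp add: field_simps)
  qed (use c(1) in auto)
  with l show ?thesis by (simp add: resolvent_norm_def)
qed

text \<open>Fixing one \<open>l0\<close> in the resolvent set turns the family of unbounded operators \<open>l - A\<close> into
  a family of bounded operators, affine in \<open>l\<close>.\<close>

lemma shifted_resolvent:
  assumes "l0 \<in> resolvent_set A"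
  shows "shifted l A (resolvent l0 A u) = (u - l0 *\<^sub>C resolvent l0 A u) + l *\<^sub>C resolvent l0 A u"
proof -
  have "opfun A (resolvent l0 A u) = l0 *\<^sub>C resolvent l0 A u - u"
    using resolvent_setD(3)[OF assms, of u] by (simp add: shifted_def algebra_simps)
  then show ?thesis by (simp add: shifted_def)
qed

lemma shifted_resolvent_range:
  assumes "l0 \<in> resolvent_set A"
  shows "shifted l A ` opdom A = range (\<lambda>u. shifted l A (resolvent l0 A u))"
proof -
  have "opdom A = range (resolvent l0 A)"
    using resolvent_setD(2)[OF assms] resolvent_setD(4)[OF assms] by (metis UNIV_I image_subset_iff rangeI subsetI subset_antisym)
  then show ?thesis by (simp add: image_image)
qed

lemma resolvent_set_of_invertible:
  assumes l0: "l0 \<in> resolvent_set A"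
    and K: "boundedly_invertible (\<lambda>u. shifted l A (resolvent l0 A u))"
  shows "l \<in> resolvent_set A"
proof -
  define R where "R = resolvent l0 A"
  define K' where "K' = inv (\<lambda>u. shifted l A (R u))"
  obtain c where c: "c > 0" "\<And>u. c * norm u \<le> norm (shifted l A (R u))"
    using K by (auto simp: boundedly_invertible_def R_def)
  have K'_bcl: "bounded_clinear K'"
    unfolding K'_def R_def by (rule bounded_clinear_inv(1)[OF K c[unfolded R_def]])
  have KK': "shifted l A (R (K' u)) = u" for u
    unfolding K'_def R_def
    by (rule surj_f_inv_f[OF bij_is_surj[OF boundedly_invertibleD(2)[OF K]]])
  have K'K: "K' (shifted l A (R u)) = u" for u
    unfolding K'_def R_def
    by (rule inv_f_f[OF bij_is_inj[OF boundedly_invertibleD(2)[OF K]]])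
  show ?thesis
  proof (rule resolvent_setI[where R = "\<lambda>u. R (K' u)"])
    show "bounded_clinear (\<lambda>u. R (K' u))"
      unfolding R_def by (rule bounded_clinear_compose[OF resolvent_setD(1)[OF l0] K'_bcl])
    show "R (K' u) \<in> opdom A" for u
      unfolding R_def by (rule resolvent_setD(2)[OF l0])
    show "shifted l A (R (K' u)) = u" for u by (rule KK')
    show "R (K' (shifted l A x)) = x" if "x \<in> opdom A" for x
      using K'K[of "shifted l0 A x"] resolvent_setD(4)[OF l0 that] by (simp add: R_def)
  qed
qed

lemma fredholm_of_finite_rank_diff:
  fixes A :: "'a::complex_banach unbounded_op"
  assumes l0: "l0 \<in> resolvent_set A"
    and G: "boundedly_invertible G" "finite_rank_diff G (\<lambda>u. shifted l A (resolvent l0 A u))"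
    and fs: "\<forall>f\<in>set fs. bounded_clinear f"
    and c: "c > 0" "\<And>u. u \<in> common_kernel fs \<Longrightarrow> c * norm u \<le> norm (shifted l A (resolvent l0 A u))"
  shows "fredholm_at l A"
proof -
  define K where "K u = shifted l A (resolvent l0 A u)" for u
  note R = resolvent_setD[OF l0]
  have K: "bounded_clinear K"
    unfolding K_def shifted_resolvent[OF l0] by (intro bounded_clinear_intros R(1))
  have "finite_dimensional {u. K u = 0}"
    using finite_dimensional_kernel_of_finite_rank_diff[OF G] by (simp add: K_def)
  then obtain B where B: "finite B" "{u. K u = 0} \<subseteq> complex_vector.span B"
    by (auto simp: finite_dimensional_def)
  have "x \<in> complex_vector.span (resolvent l0 A ` B)" if x: "x \<in> opdom A" "shifted l A x = 0" for x
  proof -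
    have "shifted l0 A x \<in> complex_vector.span B"
      using B(2) R(4)[OF x(1)] x(2) by (auto simp: K_def)
    then have "resolvent l0 A (shifted l0 A x) \<in> complex_vector.span (resolvent l0 A ` B)"
    proof (induction rule: complex_vector.span_induct_alt)
      case base
      then show ?case by (simp add: bounded_clinear_simps[OF R(1)] complex_vector.span_zero)
    next
      case (step a x y)
      then show ?case
        by (simp add: bounded_clinear_simps[OF R(1)] complex_vector.span_add complex_vector.span_scale
            complex_vector.span_base)
    qed
    then show ?thesis by (simp add: R(4)[OF x(1)])
  qed
  then have "finite_dimensional {x \<in> opdom A. shifted l A x = 0}"
    unfolding finite_dimensional_def using B(1) by (intro exI[of _ "resolvent l0 A ` B"]) auto
  moreover have "closed (range K)"
    by (rule closed_range_of_lower_bound[OF K fs c(1)]) (use c(2) in \<open>simp add: K_def\<close>)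
  moreover have "finite_codimensional (range K)"
    using finite_codimensional_range_of_finite_rank_diff[OF G] by (simp add: K_def[abs_def])
  ultimately show ?thesis
    unfolding fredholm_at_def shifted_resolvent_range[OF l0] K_def by simp
qed

lemma fredholm_at_resolvent_set:
  fixes A :: "'a::complex_banach unbounded_op"
  assumes "l \<in> resolvent_set A"
  shows "fredholm_at l A"
proof (rule fredholm_of_finite_rank_diff[OF assms, where G = "\<lambda>u. u" and fs = "[]" and c = 1])
  show "boundedly_invertible (\<lambda>u :: 'a. u)" by (rule boundedly_invertible_id)
  show "finite_rank_diff (\<lambda>u. u) (\<lambda>u. shifted l A (resolvent l A u))"
    using resolvent_setD(3)[OF assms] by (auto simp: finite_rank_diff_def intro!: exI[of _ "{}"])
qed (use resolvent_setD(3)[OF assms] in auto)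

text \<open>A line consisting of regular points carries no eigenvalue, so its condition on the point
  spectrum is met automatically.\<close>

lemma resolvent_bound_le:
  assumes "essential_spectral_bound A < ereal a"
    and line: "\<And>b. Complex a b \<in> resolvent_set A"
    and bound: "\<forall>\<^sub>F b in at_infinity. resolvent_norm (Complex a b) A \<le> ereal C"
  shows "resolvent_bound A \<le> ereal a"
proof -
  have "point_spectrum A \<inter> {l. Re l = a} = {}"
  proof (rule equals0I)
    fix l assume l: "l \<in> point_spectrum A \<inter> {l. Re l = a}"
    then obtain x where x: "x \<in> opdom A" "x \<noteq> 0" "opfun A x = l *\<^sub>C x"
      by (auto simp: point_spectrum_def)
    have "l = Complex a (Im l)" using l by (simp add: complex_eq_iff)
    then have res: "l \<in> resolvent_set A" using line[of "Im l"] by simp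
    have "shifted l A x = 0" using x by (simp add: shifted_def)
    then have "x = 0"
      using resolvent_setD(4)[OF res x(1)] bounded_clinear_simps(3)[OF resolvent_setD(1)[OF res]] by simp
    with x(2) show False by simp
  qed
  moreover have "Limsup at_infinity (\<lambda>b :: real. resolvent_norm (Complex a b) A) \<le> ereal C"
    by (rule Limsup_bounded[OF bound])
  then have "Limsup at_infinity (\<lambda>b :: real. resolvent_norm (Complex a b) A) < \<infinity>"
    using le_less_trans less_ereal.simps(4) by blast
  ultimately show ?thesis
    unfolding resolvent_bound_def using assms(1) by (intro Inf_lower) auto
qed

section \<open>The resolvent bound of a generator\<close>

text \<open>If the real part of \<open>l\<close> is large, then \<open>exp (- l) T(1)\<close> has norm at most \<open>1 / 2\<close>. The truncated
  Laplace transform over \<open>[0, 1]\<close>, composed with the inverse of \<open>I - exp (- l) T(1)\<close>, is then the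
  resolvent.\<close>

lemma generator_resolvent_right_half_plane:
  fixes T :: "real \<Rightarrow> 'a::complex_banach \<Rightarrow> 'a"
  assumes T: "C0_semigroup T"
  obtains a c where "c > 0" "\<And>l. a \<le> Re l \<Longrightarrow> l \<in> resolvent_set (generator T)"
    "\<And>l x. a \<le> Re l \<Longrightarrow> x \<in> opdom (generator T) \<Longrightarrow> c * norm x \<le> norm (shifted l (generator T) x)"
proof -
  define A where "A = generator T"
  obtain N where N: "N > 0" "\<And>t x. 0 \<le> t \<Longrightarrow> t \<le> 1 \<Longrightarrow> norm (T t x) \<le> N * norm x"
    using C0_semigroup_bounded_on_interval[OF T] by metis
  define a where "a = ln (2 * N + 1)"
  have a: "a \<ge> 0" "exp (- a) * N \<le> 1 / 2"
    using N(1) by (simp_all add: a_def exp_minus field_simps)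
  have *: "l \<in> resolvent_set A" "x \<in> opdom A \<Longrightarrow> 1 / (2 * N) * norm x \<le> norm (shifted l A x)"
    if l: "a \<le> Re l" for l x
  proof -
    define J where "J = truncated_laplace T l 1"
    define E where "E u = (- exp (- l)) *\<^sub>C T 1 u" for u
    have J: "bounded_clinear J"
      unfolding J_def by (rule bounded_clinear_truncated_laplace[OF T]) simp
    have J_norm: "norm (J x) \<le> N * norm x" for x
    proof -
      have "exp (- Re l * s) \<le> 1" if "0 \<le> s" for s
        using a(1) l that by simp
      then show ?thesis
        using truncated_laplace_bound[OF T _ N(2), of 1 l 1 x] by (simp add: J_def)
    qed
    have E: "bounded_clinear E"
      unfolding E_def by (intro bounded_clinear_intros C0_semigroupD(1)[OF T]) simp
    have E_norm: "norm (E u) \<le> 1 / 2 * norm u" for u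
    proof -
      have "norm (E u) = exp (- Re l) * norm (T 1 u)"
        by (simp add: E_def norm_scaleC norm_exp_eq_Re)
      also have "\<dots> \<le> exp (- a) * (N * norm u)"
        using l N(2)[of 1 u] by (intro mult_mono) auto
      also have "\<dots> \<le> 1 / 2 * norm u"
        using mult_right_mono[OF a(2), of "norm u"] by (simp add: mult.assoc)
      finally show ?thesis .
    qed
    define P where "P = (\<lambda>u. u + E u)"
    have P: "boundedly_invertible P" "\<And>u. 1 / 2 * norm u \<le> norm (P u)"
      using boundedly_invertible_perturb[OF boundedly_invertible_id, of 1 E "1 / 2"] E E_norm by (auto simp: P_def)
    have half: "1 / 2 > (0 :: real)" by simp
    note P' = bounded_clinear_inv(1)[OF P(1) half P(2)]
    have right: "J u \<in> opdom A" "shifted l A (J u) = P u" for u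
      using truncated_laplace_right_inverse[OF T, of 1 l u] by (simp_all add: A_def J_def P_def E_def)
    have left: "J (shifted l A x) = P x" if "x \<in> opdom A" for x
      using truncated_laplace_left_inverse[OF T, of 1 x l] that by (simp add: A_def J_def P_def E_def)
    have PP: "P (inv P u) = u" for u
      by (rule surj_f_inv_f[OF bij_is_surj[OF boundedly_invertibleD(2)[OF P(1)]]])
    have P_inj: "x = y" if "P x = P y" for x y
      using bij_is_inj[OF boundedly_invertibleD(2)[OF P(1)]] that by (rule injD)
    show "l \<in> resolvent_set A"
    proof (rule resolvent_setI[where R = "\<lambda>u. J (inv P u)"])
      show "bounded_clinear (\<lambda>u. J (inv P u))"
        by (rule bounded_clinear_compose[OF J P'])
      show "J (inv P u) \<in> opdom A" "shifted l A (J (inv P u)) = u" for u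
        by (simp_all add: right PP)
      fix x assume x: "x \<in> opdom A"
      have "P (J (inv P (shifted l A x))) = J (shifted l A (J (inv P (shifted l A x))))"
        by (simp only: left[OF right(1)])
      also have "\<dots> = P x"
        by (simp add: right(2) PP left[OF x])
      finally show "J (inv P (shifted l A x)) = x" by (rule P_inj)
    qed
    show "1 / (2 * N) * norm x \<le> norm (shifted l A x)" if "x \<in> opdom A"
      using P(2)[of x] J_norm[of "shifted l A x"] N(1) left[OF that] by (simp add: field_simps)
  qed
  show thesis
    by (rule that[of "1 / (2 * N)" a]) (use N(1) * in \<open>auto simp: A_def\<close>)
qed

lemma essential_spectral_bound_le:
  assumes "\<And>l. a < Re l \<Longrightarrow> fredholm_at l A"
  shows "essential_spectral_bound A \<le> ereal a"
  unfolding essential_spectral_bound_def essential_spectrum_def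
  using assms by (intro SUP_least) (auto simp: not_less[symmetric])

lemma resolvent_bound_generator_not_infinity:
  fixes T :: "real \<Rightarrow> 'a::complex_banach \<Rightarrow> 'a"
  assumes T: "C0_semigroup T"
  shows "resolvent_bound (generator T) \<noteq> \<infinity>"
proof -
  obtain a c where ac: "c > 0" "\<And>l. a \<le> Re l \<Longrightarrow> l \<in> resolvent_set (generator T)"
    "\<And>l x. a \<le> Re l \<Longrightarrow> x \<in> opdom (generator T) \<Longrightarrow> c * norm x \<le> norm (shifted l (generator T) x)"
    using generator_resolvent_right_half_plane[OF T] by metis
  have "resolvent_bound (generator T) \<le> ereal (a + 1)"
  proof (rule resolvent_bound_le)
    have "essential_spectral_bound (generator T) \<le> ereal a"
      by (intro essential_spectral_bound_le fredholm_at_resolvent_set ac(2)) simp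
    then show "essential_spectral_bound (generator T) < ereal (a + 1)"
      by (rule le_less_trans) simp
    show "Complex (a + 1) b \<in> resolvent_set (generator T)" for b
      by (rule ac(2)) simp
    show "\<forall>\<^sub>F b in at_infinity. resolvent_norm (Complex (a + 1) b) (generator T) \<le> ereal (1 / c)"
      by (intro always_eventually allI resolvent_norm_le ac) auto
  qed
  then show ?thesis by auto
qed

section \<open>Approximate eigenvectors\<close>

text \<open>Duhamel's formula: \<open>T(t) x - exp (l t) x\<close> is \<open>- exp (l t)\<close> times the truncated Laplace transform of
  \<open>(l - A) x\<close>. So approximate eigenvectors of \<open>A\<close> have almost exponential orbits, uniformly for \<open>l\<close> in a
  vertical strip.\<close>

lemma semigroup_near_exponential:
  fixes T :: "real \<Rightarrow> 'a::complex_banach \<Rightarrow> 'a"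
  assumes T: "C0_semigroup T" and "0 \<le> t0"
  obtains C where "C > 0"
    "\<And>l x t. \<bar>Re l\<bar> \<le> r \<Longrightarrow> x \<in> opdom (generator T) \<Longrightarrow> 0 \<le> t \<Longrightarrow> t \<le> t0 \<Longrightarrow>
      norm (T t x - exp (l * complex_of_real t) *\<^sub>C x) \<le> C * norm (shifted l (generator T) x)"
proof -
  obtain N where N: "N > 0" "\<And>t x. 0 \<le> t \<Longrightarrow> t \<le> t0 \<Longrightarrow> norm (T t x) \<le> N * norm x"
    using C0_semigroup_bounded_on_interval[OF T] by metis
  define E where "E = exp (\<bar>r\<bar> * t0)"
  have *: "norm (T t x - exp (l * complex_of_real t) *\<^sub>C x) \<le> (E * (E * N * t0) + 1) * norm (shifted l (generator T) x)"
    if r: "\<bar>Re l\<bar> \<le> r" and x: "x \<in> opdom (generator T)" and t: "0 \<le> t" "t \<le> t0" for l x t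
  proof -
    define w where "w = shifted l (generator T) x"
    have E: "exp (a * s) \<le> E" if "\<bar>a\<bar> \<le> r" "0 \<le> s" "s \<le> t0" for a s
    proof -
      have "a * s \<le> \<bar>r\<bar> * s" using that by (intro mult_right_mono) auto
      also have "\<dots> \<le> \<bar>r\<bar> * t0" using that by (intro mult_left_mono) auto
      finally show ?thesis by (simp add: E_def)
    qed
    have "exp (l * complex_of_real t) *\<^sub>C truncated_laplace T l t w
        = exp (l * complex_of_real t) *\<^sub>C x - T t x"
      unfolding w_def truncated_laplace_left_inverse[OF T t(1) x]
      by (simp add: complex_vector.scale_right_diff_distrib scaleC_scaleC flip: exp_add)
    then have "norm (T t x - exp (l * complex_of_real t) *\<^sub>C x)
        = norm (exp (l * complex_of_real t) *\<^sub>C truncated_laplace T l t w)"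
      by (simp add: norm_minus_commute)
    also have "\<dots> = exp (Re l * t) * norm (truncated_laplace T l t w)"
      by (simp add: norm_scaleC norm_exp_eq_Re)
    also have "\<dots> \<le> E * (E * N * t * norm w)"
      using r t E[of "Re l" t] E[of "- Re l"] N
      by (intro mult_mono truncated_laplace_bound[OF T]) (auto simp: E_def)
    also have "\<dots> \<le> E * (E * N * t0 * norm w)"
      using t N(1) by (intro mult_left_mono mult_right_mono) (auto simp: E_def)
    also have "\<dots> \<le> (E * (E * N * t0) + 1) * norm w"
      by (simp add: algebra_simps)
    finally show ?thesis by (simp add: w_def)
  qed
  show thesis
    by (rule that[OF _ *]) (use N(1) \<open>0 \<le> t0\<close> in \<open>auto simp: E_def intro!: add_nonneg_pos\<close>)
qed

text \<open>By induction: a correction along one further vector annihilates one more functional, and the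
  boundedness of that functional controls how much the previous corrections changed it.\<close>

lemma common_kernel_approximation:
  fixes fs :: "('a::complex_normed_vector \<Rightarrow> complex) list"
  assumes "\<forall>f\<in>set fs. bounded_clinear f"
  shows "\<exists>\<kappa>\<ge>0. \<forall>x. \<exists>y\<in>common_kernel fs. norm (x - y) \<le> \<kappa> * (\<Sum>f\<leftarrow>fs. norm (f x))"
  using assms
proof (induction fs)
  case Nil
  show ?case by (intro exI[of _ 0] conjI allI) auto
next
  case (Cons f fs)
  have f: "bounded_clinear f" and fs: "\<forall>g\<in>set fs. bounded_clinear g"
    using Cons.prems by auto
  obtain \<kappa> where \<kappa>: "\<kappa> \<ge> 0" "\<forall>x. \<exists>y\<in>common_kernel fs. norm (x - y) \<le> \<kappa> * (\<Sum>f\<leftarrow>fs. norm (f x))"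
    using Cons.IH[OF fs] by blast
  have S: "0 \<le> (\<Sum>f\<leftarrow>fs. norm (f x))" for x
    by (intro sum_list_nonneg) auto
  show ?case
  proof (cases "\<exists>u\<in>common_kernel fs. f u \<noteq> 0")
    case False
    then have eq: "common_kernel (f # fs) = common_kernel fs" by auto
    have "\<exists>y\<in>common_kernel (f # fs). norm (x - y) \<le> \<kappa> * (\<Sum>f\<leftarrow>f # fs. norm (f x))" for x
    proof -
      obtain y where "y \<in> common_kernel fs" "norm (x - y) \<le> \<kappa> * (\<Sum>f\<leftarrow>fs. norm (f x))"
        using \<kappa>(2) by blast
      moreover have "\<kappa> * (\<Sum>f\<leftarrow>fs. norm (f x)) \<le> \<kappa> * (\<Sum>f\<leftarrow>f # fs. norm (f x))"
        using \<kappa>(1) by (intro mult_left_mono) auto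
      ultimately show ?thesis unfolding eq by (intro bexI[of _ y]) auto
    qed
    with \<kappa>(1) show ?thesis by blast
  next
    case True
    then obtain z where z: "z \<in> common_kernel fs" "f z = 1"
      using common_kernel_normalized_vector[OF f bspec[OF fs]] by metis
    obtain K where K: "K > 0" "\<And>x. norm (f x) \<le> K * norm x"
      using bounded_clinear_bound[OF f] by blast
    note sub = subspace_common_kernel[OF bspec[OF fs]]
    have "\<exists>y\<in>common_kernel (f # fs). norm (x - y) \<le> (\<kappa> + norm z + K * \<kappa> * norm z) * (\<Sum>f\<leftarrow>f # fs. norm (f x))" for x
    proof -
      define s where "s = (\<Sum>f\<leftarrow>fs. norm (f x))"
      obtain y where y: "y \<in> common_kernel fs" "norm (x - y) \<le> \<kappa> * s"
        using \<kappa>(2) unfolding s_def by blast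
      have "y - f y *\<^sub>C z \<in> common_kernel (f # fs)"
        using y z sub
        by (simp add: bounded_clinear_simps[OF f] scaleC_complex_def complex_vector.subspace_diff
            complex_vector.subspace_scale)
      moreover have "norm (x - (y - f y *\<^sub>C z)) \<le> (\<kappa> + norm z + K * \<kappa> * norm z) * (norm (f x) + s)"
      proof -
        have "norm (f y) \<le> norm (f x) + norm (f (x - y))"
          using norm_triangle_ineq4[of "f x" "f (x - y)"] by (simp add: bounded_clinear_simps[OF f])
        also have "norm (f (x - y)) \<le> K * (\<kappa> * s)"
          using order_trans[OF K(2) mult_left_mono[OF y(2)]] K(1) by simp
        finally have fy: "norm (f y) \<le> norm (f x) + K * (\<kappa> * s)" by simp
        have "norm (x - (y - f y *\<^sub>C z)) \<le> norm (x - y) + norm (f y) * norm z"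
          using norm_triangle_ineq[of "x - y" "f y *\<^sub>C z"] by (simp add: norm_scaleC algebra_simps)
        also have "\<dots> \<le> \<kappa> * s + (norm (f x) + K * (\<kappa> * s)) * norm z"
          by (intro add_mono y(2) mult_right_mono fy) simp
        also have "\<dots> \<le> (\<kappa> + norm z + K * \<kappa> * norm z) * (norm (f x) + s)"
          using \<kappa>(1) K(1) S[of x] by (simp add: algebra_simps s_def add_nonneg_nonneg)
        finally show ?thesis .
      qed
      ultimately show ?thesis by (intro bexI) (simp_all add: s_def)
    qed
    moreover have "0 \<le> \<kappa> + norm z + K * \<kappa> * norm z" using \<kappa>(1) K(1) by simp
    ultimately show ?thesis by blast
  qed
qed

text \<open>For \<open>f\<close> in the domain of the adjoint, \<open>l f(x) = f((l - A) x) + (A\<^sup>* f)(x)\<close>, so the values of \<open>f\<close> on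
  normalized approximate eigenvectors are of order \<open>1 / l\<close>. This is where the restriction to functionals
  from \<open>D(A\<^sup>*)\<close> enters.\<close>

lemma adjoint_dom_decay:
  assumes "\<forall>f\<in>set fs. f \<in> adjoint_dom A"
  shows "\<exists>b\<ge>0. \<forall>l. \<forall>x\<in>opdom A.
    norm l * (\<Sum>f\<leftarrow>fs. norm (f x)) \<le> b * (norm (shifted l A x) + norm x)"
  using assms
proof (induction fs)
  case Nil
  show ?case by (intro exI[of _ 0]) auto
next
  case (Cons f fs)
  obtain b where b: "b \<ge> 0" "\<forall>l. \<forall>x\<in>opdom A.
      norm l * (\<Sum>f\<leftarrow>fs. norm (f x)) \<le> b * (norm (shifted l A x) + norm x)"
    using Cons.IH Cons.prems by auto
  obtain g where f: "bounded_clinear f" and g: "bounded_clinear g" "\<And>x. x \<in> opdom A \<Longrightarrow> f (opfun A x) = g x"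
    using Cons.prems by (auto simp: adjoint_dom_def)
  obtain K L where K: "K > 0" "\<And>x. norm (f x) \<le> K * norm x" and L: "L > 0" "\<And>x. norm (g x) \<le> L * norm x"
    using bounded_clinear_bound[OF f] bounded_clinear_bound[OF g(1)] by metis
  have "norm l * (\<Sum>f\<leftarrow>f # fs. norm (f x)) \<le> (b + K + L) * (norm (shifted l A x) + norm x)"
    if x: "x \<in> opdom A" for l x
  proof -
    have "l * f x = f (shifted l A x) + g x"
      using g(2)[OF x] by (simp add: shifted_def bounded_clinear_simps[OF f] scaleC_complex_def)
    then have "norm l * norm (f x) \<le> K * norm (shifted l A x) + L * norm x"
      using norm_triangle_ineq[of "f (shifted l A x)" "g x"] K(2)[of "shifted l A x"] L(2)[of x]
      by (simp flip: norm_mult)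
    also have "\<dots> \<le> (K + L) * (norm (shifted l A x) + norm x)"
      using K(1) L(1) by (simp add: algebra_simps)
    finally have "norm l * norm (f x) \<le> (K + L) * (norm (shifted l A x) + norm x)" .
    moreover have "norm l * (\<Sum>f\<leftarrow>fs. norm (f x)) \<le> b * (norm (shifted l A x) + norm x)"
      using b(2) x by blast
    ultimately show ?thesis by (simp add: algebra_simps)
  qed
  moreover have "b + K + L \<ge> 0" using b(1) K(1) L(1) by simp
  ultimately show ?case by blast
qed

lemma abs_exp_minus_one_le:
  fixes u :: real
  assumes "\<bar>u\<bar> \<le> d"
  shows "\<bar>exp u - 1\<bar> \<le> exp d - 1"
proof (cases "u \<ge> 0")
  case False
  have "1 - exp u \<le> exp (- u) - 1"
    using exp_ge_add_one_self[of u] exp_ge_add_one_self[of "- u"] by linarith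
  also have "exp (- u) \<le> exp d" using assms by simp
  finally show ?thesis using False by simp
qed (use assms in simp)

text \<open>Let \<open>x\<close> be an approximate eigenvector for \<open>l\<close> close to the line \<open>Re = \<omega>\<close>. If \<open>x\<close> lies in the common
  kernel, its orbit contradicts \<open>far\<close> by \<open>semigroup_near_exponential\<close>. If instead \<open>l\<close> is large, then \<open>x\<close> is
  close to some \<open>y\<close> in the common kernel by \<open>adjoint_dom_decay\<close>, and the orbit of \<open>y\<close> contradicts \<open>far\<close>; for
  this step \<open>y\<close> may lie outside the domain of the generator.\<close>

lemma lower_bounds_of_not_almost_exponential:
  fixes T :: "real \<Rightarrow> 'a::complex_banach \<Rightarrow> 'a" and \<omega> :: real
  assumes T: "C0_semigroup T" and fs: "\<forall>f\<in>set fs. f \<in> adjoint_dom (generator T)"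
    and t0: "t0 > 0" and \<epsilon>: "\<epsilon> > 0"
    and far: "\<And>x \<mu>. x \<in> common_kernel fs \<Longrightarrow> Re \<mu> = \<omega> \<Longrightarrow>
      \<exists>t\<in>{0..t0}. \<epsilon> * norm x \<le> norm (T t x - exp (\<mu> * complex_of_real t) *\<^sub>C x)"
  obtains \<delta> c L where "\<delta> > 0" "c > 0"
    "\<And>l x. \<bar>Re l - \<omega>\<bar> < \<delta> \<Longrightarrow> x \<in> opdom (generator T) \<Longrightarrow> x \<in> common_kernel fs \<or> L \<le> norm l \<Longrightarrow>
      c * norm x \<le> norm (shifted l (generator T) x)"
proof -
  define A where "A = generator T"
  have fs_bcl: "\<forall>f\<in>set fs. bounded_clinear f"
    using fs by (auto simp: adjoint_dom_def)
  obtain N where N: "N > 0" "\<And>t x. 0 \<le> t \<Longrightarrow> t \<le> t0 \<Longrightarrow> norm (T t x) \<le> N * norm x"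
    using C0_semigroup_bounded_on_interval[OF T] by metis
  obtain C where C: "C > 0" "\<And>l x t. \<bar>Re l\<bar> \<le> \<bar>\<omega>\<bar> + 1 \<Longrightarrow> x \<in> opdom A \<Longrightarrow> 0 \<le> t \<Longrightarrow> t \<le> t0 \<Longrightarrow>
      norm (T t x - exp (l * complex_of_real t) *\<^sub>C x) \<le> C * norm (shifted l A x)"
    using semigroup_near_exponential[OF T, of t0 "\<bar>\<omega>\<bar> + 1"] t0 unfolding A_def by (metis less_imp_le)
  obtain \<kappa> where \<kappa>: "\<kappa> \<ge> 0" "\<forall>x. \<exists>y\<in>common_kernel fs. norm (x - y) \<le> \<kappa> * (\<Sum>f\<leftarrow>fs. norm (f x))"
    using common_kernel_approximation[OF fs_bcl] by blast
  obtain b where b: "b \<ge> 0" "\<forall>l. \<forall>x\<in>opdom A.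
      norm l * (\<Sum>f\<leftarrow>fs. norm (f x)) \<le> b * (norm (shifted l A x) + norm x)"
    using adjoint_dom_decay[OF fs] unfolding A_def by blast
  define E where "E = exp (\<bar>\<omega>\<bar> * t0)"
  \<comment> \<open>Chosen such that \<open>exp (l t)\<close> and \<open>exp (\<mu> t)\<close> differ by at most \<open>\<epsilon> / 4\<close> on \<open>[0, t0]\<close> if \<open>\<mu>\<close> is the
    horizontal projection of \<open>l\<close> to the line \<open>Re = \<omega>\<close>.\<close>
  define \<delta> where "\<delta> = min 1 (ln (1 + \<epsilon> / (4 * E)) / t0)"
  have E: "E > 0" by (simp add: E_def)
  have "\<epsilon> / (4 * E) > 0" using \<epsilon> E by simp
  then have "ln (1 + \<epsilon> / (4 * E)) > 0" by (intro ln_gt_zero) simp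
  then have \<delta>: "\<delta> > 0" "\<delta> \<le> 1"
    using t0 by (simp_all add: \<delta>_def)
  have "\<delta> * t0 \<le> ln (1 + \<epsilon> / (4 * E))"
    using t0 by (simp add: \<delta>_def min_def field_simps)
  then have "exp (\<delta> * t0) \<le> exp (ln (1 + \<epsilon> / (4 * E)))" by simp
  also have "\<dots> = 1 + \<epsilon> / (4 * E)"
    using \<epsilon> E by (intro exp_ln) (simp add: add_pos_pos)
  finally have exp_\<delta>: "E * (exp (\<delta> * t0) - 1) \<le> \<epsilon> / 4"
    using E by (simp add: field_simps)
  define C' where "C' = N + E + \<epsilon>"
  have C': "C' > 0" using N(1) E \<epsilon> by (simp add: C'_def)
  \<comment> \<open>Replacing \<open>x\<close> by \<open>y\<close> costs at most \<open>C'\<close> times their distance, which \<open>\<theta>\<close> and \<open>L\<close> make small.\<close>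
  define \<theta> where "\<theta> = min (\<epsilon> / 4) 1 / C'"
  have \<theta>: "\<theta> > 0" "C' * \<theta> \<le> \<epsilon> / 4" "C' * \<theta> \<le> 1"
    using C' \<epsilon> by (auto simp: \<theta>_def)
  define L where "L = \<kappa> * b / \<theta> + 1"
  have L: "L > 0" "\<kappa> * b \<le> \<theta> * L"
    using \<kappa>(1) b(1) \<theta>(1) by (simp_all add: L_def distrib_left add_nonneg_pos)
  define c where "c = \<epsilon> / (2 * (C + 1))"
  have "c > 0" using \<epsilon> C(1) by (simp add: c_def)
  have main: "c * norm x \<le> norm (shifted l A x)"
    if l: "\<bar>Re l - \<omega>\<bar> < \<delta>" and x: "x \<in> opdom A" and xl: "x \<in> common_kernel fs \<or> L \<le> norm l" for l x
  proof -
    define w where "w = norm (shifted l A x)"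
    have "\<exists>y\<in>common_kernel fs. norm (x - y) \<le> \<theta> * (w + norm x)"
      using xl
    proof
      assume "x \<in> common_kernel fs"
      then show ?thesis
        using \<theta>(1) by (intro bexI[of _ x]) (auto simp: w_def)
    next
      assume Ll: "L \<le> norm l"
      obtain y where y: "y \<in> common_kernel fs" "norm (x - y) \<le> \<kappa> * (\<Sum>f\<leftarrow>fs. norm (f x))"
        using \<kappa>(2) by blast
      have S: "0 \<le> (\<Sum>f\<leftarrow>fs. norm (f x))" by (intro sum_list_nonneg) auto
      have "L * norm (x - y) \<le> L * (\<kappa> * (\<Sum>f\<leftarrow>fs. norm (f x)))"
        using y(2) L(1) by (intro mult_left_mono) auto
      also have "\<dots> = \<kappa> * (L * (\<Sum>f\<leftarrow>fs. norm (f x)))" by simp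
      also have "\<dots> \<le> \<kappa> * (norm l * (\<Sum>f\<leftarrow>fs. norm (f x)))"
        using Ll S \<kappa>(1) by (intro mult_left_mono mult_right_mono) auto
      also have "\<dots> \<le> \<kappa> * (b * (w + norm x))"
        using b(2) x \<kappa>(1) by (intro mult_left_mono) (auto simp: w_def)
      also have "\<dots> = (\<kappa> * b) * (w + norm x)" by simp
      also have "\<dots> \<le> (\<theta> * L) * (w + norm x)"
        by (intro mult_right_mono L(2)) (simp add: w_def)
      finally have "L * norm (x - y) \<le> L * (\<theta> * (w + norm x))" by (simp add: ac_simps)
      then have "norm (x - y) \<le> \<theta> * (w + norm x)" using L(1) by simp
      with y(1) show ?thesis by blast
    qed
    then obtain y where y: "y \<in> common_kernel fs" "norm (x - y) \<le> \<theta> * (w + norm x)" by blast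
    define \<mu> where "\<mu> = Complex \<omega> (Im l)"
    obtain t where t: "t \<in> {0..t0}" "\<epsilon> * norm y \<le> norm (T t y - exp (\<mu> * complex_of_real t) *\<^sub>C y)"
      using far[OF y(1), of \<mu>] by (auto simp: \<mu>_def)
    have exp_le: "exp (\<omega> * t) \<le> E"
    proof -
      have "\<omega> * t \<le> \<bar>\<omega>\<bar> * t" using t(1) by (intro mult_right_mono) auto
      also have "\<dots> \<le> \<bar>\<omega>\<bar> * t0" using t(1) by (intro mult_left_mono) auto
      finally show ?thesis by (simp add: E_def)
    qed
    have "norm (exp (l * complex_of_real t) - exp (\<mu> * complex_of_real t)) \<le> \<epsilon> / 4"
    proof -
      have eq: "l * complex_of_real t = \<mu> * complex_of_real t + complex_of_real ((Re l - \<omega>) * t)"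
        by (simp add: complex_eq_iff \<mu>_def algebra_simps)
      have "exp (l * complex_of_real t) - exp (\<mu> * complex_of_real t)
          = exp (\<mu> * complex_of_real t) * complex_of_real (exp ((Re l - \<omega>) * t) - 1)"
        unfolding eq exp_add exp_of_real by (simp add: right_diff_distrib)
      then have "norm (exp (l * complex_of_real t) - exp (\<mu> * complex_of_real t))
          = exp (\<omega> * t) * \<bar>exp ((Re l - \<omega>) * t) - 1\<bar>"
        by (simp only: norm_mult norm_of_real) (simp add: norm_exp_eq_Re \<mu>_def)
      also have "\<dots> \<le> E * (exp (\<delta> * t0) - 1)"
      proof (intro mult_mono exp_le abs_exp_minus_one_le)
        show "\<bar>(Re l - \<omega>) * t\<bar> \<le> \<delta> * t0"
          unfolding abs_mult using l t(1) \<delta>(1) by (intro mult_mono) auto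
      qed (use E in auto)
      finally show ?thesis using exp_\<delta> by simp
    qed
    then have lm: "norm ((exp (l * complex_of_real t) - exp (\<mu> * complex_of_real t)) *\<^sub>C x) \<le> \<epsilon> / 4 * norm x"
      by (simp only: norm_scaleC) (intro mult_right_mono norm_ge_zero)
    have xl: "norm (T t x - exp (l * complex_of_real t) *\<^sub>C x) \<le> C * w"
      unfolding w_def using l \<delta>(2) t(1) by (intro C(2) x) auto
    have x_split: "T t x - exp (\<mu> * complex_of_real t) *\<^sub>C x
        = (T t x - exp (l * complex_of_real t) *\<^sub>C x) + (exp (l * complex_of_real t) - exp (\<mu> * complex_of_real t)) *\<^sub>C x"
      by (simp add: complex_vector.scale_left_diff_distrib)
    have x_far: "norm (T t x - exp (\<mu> * complex_of_real t) *\<^sub>C x) \<le> C * w + \<epsilon> / 4 * norm x"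
      unfolding x_split by (rule norm_triangle_le) (use xl lm in linarith)
    have y_split: "T t y - exp (\<mu> * complex_of_real t) *\<^sub>C y
        = (T t x - exp (\<mu> * complex_of_real t) *\<^sub>C x) - (T t (x - y) - exp (\<mu> * complex_of_real t) *\<^sub>C (x - y))"
      using t(1) by (simp add: bounded_clinear_simps[OF C0_semigroupD(1)[OF T]] complex_vector.scale_right_diff_distrib)
    have xy: "norm (T t (x - y) - exp (\<mu> * complex_of_real t) *\<^sub>C (x - y)) \<le> (N + E) * norm (x - y)"
    proof -
      have "norm (exp (\<mu> * complex_of_real t) *\<^sub>C (x - y)) \<le> E * norm (x - y)"
        using exp_le by (auto simp: norm_scaleC norm_exp_eq_Re \<mu>_def intro!: mult_right_mono)
      moreover have "norm (T t (x - y)) \<le> N * norm (x - y)"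
        using t(1) by (intro N(2)) auto
      ultimately show ?thesis
        using norm_triangle_ineq4[of "T t (x - y)" "exp (\<mu> * complex_of_real t) *\<^sub>C (x - y)"]
        unfolding distrib_right by linarith
    qed
    have "norm (T t y - exp (\<mu> * complex_of_real t) *\<^sub>C y) \<le> C * w + \<epsilon> / 4 * norm x + (N + E) * norm (x - y)"
      unfolding y_split by (rule norm_triangle_le_diff) (use x_far xy in linarith)
    with t(2) have "\<epsilon> * norm y \<le> C * w + \<epsilon> / 4 * norm x + (N + E) * norm (x - y)"
      by (rule order_trans)
    moreover have "\<epsilon> * norm x \<le> \<epsilon> * norm y + \<epsilon> * norm (x - y)"
      using norm_triangle_ineq[of y "x - y"] \<epsilon> by (simp flip: distrib_left)
    ultimately have "\<epsilon> * norm x \<le> C * w + \<epsilon> / 4 * norm x + C' * norm (x - y)"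
      unfolding C'_def distrib_right by linarith
    also have "C' * norm (x - y) \<le> C' * (\<theta> * (w + norm x))"
      using C' y(2) by (intro mult_left_mono) auto
    also have "C' * (\<theta> * (w + norm x)) = C' * \<theta> * w + C' * \<theta> * norm x"
      by (simp add: algebra_simps)
    also have "\<dots> \<le> 1 * w + \<epsilon> / 4 * norm x"
      using \<theta> by (intro add_mono mult_right_mono) (auto simp: w_def)
    finally have "\<epsilon> / 2 * norm x \<le> (C + 1) * w"
      by (simp add: algebra_simps)
    then show ?thesis
      using C(1) by (simp add: c_def w_def field_simps)
  qed
  show thesis
    by (rule that[OF \<delta>(1) \<open>c > 0\<close> main[unfolded A_def]])
qed

section \<open>Admissibility of the resolvent bound\<close>

text \<open>The strip contains a regular point \<open>l0\<close>, because some line \<open>Re = a\<close> with \<open>\<omega> \<le> a < \<omega> + \<delta>\<close>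
  carries regular points. By means of the resolvent at \<open>l0\<close> the operators \<open>l - A\<close> become an affine family of bounded
  operators, to which \<open>invertible_off_countable_on_connected\<close> applies: in the whole strip \<open>l - A\<close> is Fredholm, and
  invertible for all but countably many \<open>l\<close>. Hence some line \<open>Re = a'\<close> with \<open>\<omega> - \<delta> < a' < \<omega>\<close> consists of
  regular points, and the lower bound for large \<open>l\<close> bounds the resolvent along it. So the resolvent bound
  is at most \<open>a'\<close>, a contradiction.\<close>

lemma no_lower_bounds_near_resolvent_bound:
  fixes A :: "'a::complex_banach unbounded_op"
  assumes \<omega>: "resolvent_bound A = ereal \<omega>"
    and fs: "\<forall>f\<in>set fs. bounded_clinear f"
    and \<delta>: "\<delta> > 0" and c: "c > 0"
    and low: "\<And>l x. \<bar>Re l - \<omega>\<bar> < \<delta> \<Longrightarrow> x \<in> opdom A \<Longrightarrow> x \<in> common_kernel fs \<or> L \<le> norm l \<Longrightarrow>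
      c * norm x \<le> norm (shifted l A x)"
  shows False
proof -
  define U where "U = {l. \<bar>Re l - \<omega>\<bar> < \<delta>}"
  have U_eq: "U = {l. \<omega> - \<delta> < Re l} \<inter> {l. Re l < \<omega> + \<delta>}"
    by (auto simp: U_def)
  have U: "open U" "connected U"
    unfolding U_eq
    by (intro open_Int open_halfspace_Re_gt open_halfspace_Re_lt)
      (intro convex_connected convex_Int convex_halfspace_Re_gt convex_halfspace_Re_lt)
  define S where "S = {ereal a | a :: real. essential_spectral_bound A < ereal a \<and>
     finite (point_spectrum A \<inter> {l. Re l = a}) \<and>
     Limsup at_infinity (\<lambda>b :: real. resolvent_norm (Complex a b) A) < \<infinity>}"
  have S: "Inf S = ereal \<omega>"
    using \<omega> by (simp add: resolvent_bound_def S_def)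
  have esb: "essential_spectral_bound A \<le> ereal \<omega>"
    unfolding S[symmetric] by (intro Inf_greatest) (auto simp: S_def)
  have "Inf S < ereal (\<omega> + \<delta>)" using S \<delta> by simp
  then obtain a where a: "ereal a \<in> S" "a < \<omega> + \<delta>"
    unfolding Inf_less_iff by (auto simp: S_def)
  have "\<omega> \<le> a"
    using Inf_lower[OF a(1)] S by simp
  have "Limsup at_infinity (\<lambda>b :: real. resolvent_norm (Complex a b) A) < \<infinity>"
    using a(1) by (auto simp: S_def)
  then have "\<forall>\<^sub>F b in at_infinity. resolvent_norm (Complex a b) A < \<infinity>"
    by (rule Limsup_lessD)
  then obtain b where b: "resolvent_norm (Complex a b) A < \<infinity>"
    using eventually_happens'[OF trivial_limit_at_infinity] by blast
  define l0 where "l0 = Complex a b"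
  have l0: "l0 \<in> resolvent_set A"
    using b by (auto simp: resolvent_norm_def l0_def split: if_splits)
  have l0U: "l0 \<in> U"
    using a(2) \<open>\<omega> \<le> a\<close> by (simp add: U_def l0_def)
  define R where "R = resolvent l0 A"
  note R = resolvent_setD[OF l0, folded R_def]
  define B where "B u = u - l0 *\<^sub>C R u" for u
  have K: "shifted l A (R u) = B u + l *\<^sub>C R u" for l u
    unfolding R_def B_def by (rule shifted_resolvent[OF l0])
  define gs where "gs = map (\<lambda>f u. f (R u)) fs"
  have gs: "\<forall>g\<in>set gs. bounded_clinear g"
    using fs bounded_clinear_compose[OF _ R(1)] by (auto simp: gs_def)
  have R_kernel: "R u \<in> common_kernel fs" if "u \<in> common_kernel gs" for u
    using that by (auto simp: common_kernel_def gs_def)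
  \<comment> \<open>A lower bound on \<open>x = R u\<close> gives one on \<open>u\<close>, since \<open>u = (l - A) x - (l - l0) x\<close>.\<close>
  have lift: "1 / (1 + k / c) * norm u \<le> norm (B u + l *\<^sub>C R u)"
    if l: "l \<in> U" "norm (l - l0) \<le> k" and u: "R u \<in> common_kernel fs \<or> L \<le> norm l" for l u k
  proof -
    define r where "r = norm (B u + l *\<^sub>C R u)"
    have "c * norm (R u) \<le> r"
      unfolding r_def K[symmetric] using l(1) u by (intro low R(2)) (auto simp: U_def)
    then have Ru: "norm (R u) \<le> r / c" using c by (simp add: field_simps)
    have k: "0 \<le> k" using order_trans[OF norm_ge_zero l(2)] .
    have "u = (B u + l *\<^sub>C R u) - (l - l0) *\<^sub>C R u"
      by (simp add: B_def complex_vector.scale_left_diff_distrib)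
    then have "norm u \<le> r + norm (l - l0) * norm (R u)"
      using norm_triangle_ineq4[of "B u + l *\<^sub>C R u" "(l - l0) *\<^sub>C R u"] by (simp add: norm_scaleC r_def)
    also have "\<dots> \<le> r + k * (r / c)"
      using l(2) Ru k by (intro add_left_mono mult_mono) auto
    also have "\<dots> = (1 + k / c) * r" by (simp add: algebra_simps)
    finally have "norm u \<le> (1 + k / c) * r" .
    moreover have "1 + k / c > 0" using k c by (simp add: add_pos_nonneg)
    ultimately show ?thesis by (simp add: r_def field_simps)
  qed
  have low_gs: "\<exists>r>0. \<exists>c>0. \<forall>m\<in>ball l r. \<forall>u\<in>common_kernel gs. c * norm u \<le> norm (B u + m *\<^sub>C R u)"
    if l: "l \<in> U" for l
  proof -
    obtain r where r: "r > 0" "ball l r \<subseteq> U"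
      using U(1) l by (meson openE)
    define k where "k = norm (l - l0) + r"
    have "norm (m - l0) \<le> k" if "m \<in> ball l r" for m
      using that norm_triangle_ineq[of "m - l" "l - l0"] by (simp add: k_def dist_norm norm_minus_commute)
    then have "\<forall>m\<in>ball l r. \<forall>u\<in>common_kernel gs. 1 / (1 + k / c) * norm u \<le> norm (B u + m *\<^sub>C R u)"
      using r(2) R_kernel by (intro ballI lift) auto
    moreover have "1 / (1 + k / c) > 0"
      using r(1) c by (simp add: k_def add_pos_nonneg)
    ultimately show ?thesis using r(1) by (intro exI conjI)
  qed
  have "B u + l0 *\<^sub>C R u = u" for u by (simp add: B_def)
  then have inv0: "boundedly_invertible (\<lambda>u. B u + l0 *\<^sub>C R u)"
    by (simp add: boundedly_invertible_id)
  have countable: "countable {l \<in> U. \<not> boundedly_invertible (\<lambda>u. B u + l *\<^sub>C R u)}"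
    by (rule invertible_off_countable_on_connected(1)[OF R(1) gs U low_gs l0U inv0])
  have fredholm: "fredholm_at l A" if l: "l \<in> U" for l
  proof -
    obtain G where G: "boundedly_invertible G" "finite_rank_diff G (\<lambda>u. B u + l *\<^sub>C R u)"
      using invertible_off_countable_on_connected(2)[OF R(1) gs U low_gs l0U inv0 l] by blast
    define k where "k = norm (l - l0)"
    show ?thesis
    proof (rule fredholm_of_finite_rank_diff[OF l0 G(1) _ gs, folded R_def, unfolded K])
      show "finite_rank_diff G (\<lambda>u. B u + l *\<^sub>C R u)" by (rule G(2))
      show "1 / (1 + k / c) > 0" using c by (simp add: k_def add_pos_nonneg)
      show "1 / (1 + k / c) * norm u \<le> norm (B u + l *\<^sub>C R u)" if "u \<in> common_kernel gs" for u
        using l R_kernel[OF that] by (intro lift) (auto simp: k_def)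
    qed
  qed
  \<comment> \<open>All but countably many vertical lines in the strip consist of regular points.\<close>
  define Z where "Z = {l \<in> U. \<not> boundedly_invertible (\<lambda>u. B u + l *\<^sub>C R u)}"
  have "countable (Re ` Z)"
    unfolding Z_def by (intro countable_image countable)
  moreover have "uncountable {\<omega> - \<delta><..<\<omega>}"
    using \<delta> by (simp add: uncountable_open_interval)
  ultimately have "\<not> {\<omega> - \<delta><..<\<omega>} \<subseteq> Re ` Z"
    using countable_subset by blast
  then obtain a' where a': "\<omega> - \<delta> < a'" "a' < \<omega>" "a' \<notin> Re ` Z"
    unfolding subset_iff greaterThanLessThan_iff by blast
  have line: "Complex a' d \<in> U" "Complex a' d \<in> resolvent_set A" for d
  proof -
    have U': "Complex a' d \<in> U" using a' by (simp add: U_def)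
    then show "Complex a' d \<in> U" .
    have "Complex a' d \<notin> Z"
      using a'(3) by (metis complex.sel(1) imageI)
    with U' have "boundedly_invertible (\<lambda>u. B u + Complex a' d *\<^sub>C R u)"
      by (simp add: Z_def)
    then show "Complex a' d \<in> resolvent_set A"
      by (intro resolvent_set_of_invertible[OF l0]) (simp add: R_def[symmetric] K)
  qed
  have "resolvent_bound A \<le> ereal a'"
  proof (rule resolvent_bound_le)
    have "essential_spectral_bound A \<le> ereal (\<omega> - \<delta>)"
    proof (rule essential_spectral_bound_le)
      fix l assume l: "\<omega> - \<delta> < Re l"
      show "fredholm_at l A"
      proof (cases "Re l \<le> \<omega>")
        case True
        with l \<delta> show ?thesis by (intro fredholm) (simp add: U_def)
      next
        case False
        show ?thesis
        proof (rule ccontr)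
          assume "\<not> fredholm_at l A"
          then have "ereal (Re l) \<le> essential_spectral_bound A"
            unfolding essential_spectral_bound_def essential_spectrum_def by (intro SUP_upper) simp
          with esb have "ereal (Re l) \<le> ereal \<omega>" by (rule order_trans[rotated])
          with False show False by simp
        qed
      qed
    qed
    then show "essential_spectral_bound A < ereal a'"
      by (rule le_less_trans) (use a' in simp)
    show "Complex a' d \<in> resolvent_set A" for d by (rule line)
    have "resolvent_norm (Complex a' d) A \<le> ereal (1 / c)" if d: "L \<le> norm d" for d :: real
    proof (rule resolvent_norm_le[OF line(2) c])
      have "L \<le> norm (Complex a' d)"
        using d abs_Im_le_cmod[of "Complex a' d"] by simp
      then show "c * norm x \<le> norm (shifted (Complex a' d) A x)" if "x \<in> opdom A" for x
        using line(1)[of d] that by (intro low) (auto simp: U_def)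
    qed
    then show "\<forall>\<^sub>F d in at_infinity. resolvent_norm (Complex a' d) A \<le> ereal (1 / c)"
      unfolding eventually_at_infinity by blast
  qed
  with \<omega> a'(2) show False by simp
qed

theorem theorem2p2:
  fixes T :: "real \<Rightarrow> 'a::complex_banach \<Rightarrow> 'a" and A :: "'a unbounded_op"
  assumes "\<not> finite_dimensional (UNIV :: 'a set)"
    and "C0_semigroup T"
    and "A = generator T"
    and "resolvent_bound A \<noteq> -\<infinity>"
  shows "\<exists>\<omega>::real. resolvent_bound A = ereal \<omega> \<and> admissible T \<omega>"
proof -
  note T = \<open>C0_semigroup T\<close>
  have "resolvent_bound A \<noteq> \<infinity>"
    using resolvent_bound_generator_not_infinity[OF T] assms(3) by simp
  with assms(4) obtain \<omega> where \<omega>: "resolvent_bound A = ereal \<omega>"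
    by (cases "resolvent_bound A") auto
  have "admissible T \<omega>"
    unfolding admissible_def
  proof (intro allI impI)
    fix t0 \<epsilon> :: real and M :: "'a set"
    assume t0: "t0 > 0" and \<epsilon>: "\<epsilon> > 0"
      and "\<exists>(n::nat) y. (\<forall>j\<in>{1..n}. y j \<in> adjoint_dom (generator T)) \<and> M = (\<Inter>j\<in>{1..n}. {x. y j x = 0})"
    then obtain n :: nat and y where y: "\<forall>j\<in>{1..n}. y j \<in> adjoint_dom (generator T)"
      and M: "M = (\<Inter>j\<in>{1..n}. {x. y j x = 0})" by blast
    define fs where "fs = map y [1..<Suc n]"
    have M_eq: "M = common_kernel fs"
      by (auto simp: M fs_def common_kernel_def)
    have fs: "\<forall>f\<in>set fs. f \<in> adjoint_dom (generator T)"
      using y by (auto simp: fs_def)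
    show "\<exists>x\<in>M. norm x = 1 \<and> (\<exists>\<mu>. Re \<mu> = \<omega> \<and>
      (\<forall>t\<in>{0..t0}. norm (T t x - exp (\<mu> * complex_of_real t) *\<^sub>C x) < \<epsilon>))"
    proof (rule ccontr)
      assume none: "\<not> ?thesis"
      have far: "\<exists>t\<in>{0..t0}. \<epsilon> * norm x \<le> norm (T t x - exp (\<mu> * complex_of_real t) *\<^sub>C x)"
        if x: "x \<in> common_kernel fs" and \<mu>: "Re \<mu> = \<omega>" for x \<mu>
      proof (cases "x = 0")
        case True
        then show ?thesis using t0 by (intro bexI[of _ 0]) auto
      next
        case False
        define k where "k = complex_of_real (1 / norm x)"
        have k: "norm k * norm x = 1" using False by (simp add: k_def norm_divide)
        have "k *\<^sub>C x \<in> M"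
          unfolding M_eq using fs x
          by (intro complex_vector.subspace_scale subspace_common_kernel) (auto simp: adjoint_dom_def)
        moreover have "norm (k *\<^sub>C x) = 1" using k by (simp add: norm_scaleC)
        ultimately have "\<not> (\<forall>t\<in>{0..t0}. norm (T t (k *\<^sub>C x) - exp (\<mu> * complex_of_real t) *\<^sub>C k *\<^sub>C x) < \<epsilon>)"
          using none \<mu> by blast
        then obtain t where t: "t \<in> {0..t0}"
          "\<epsilon> \<le> norm (T t (k *\<^sub>C x) - exp (\<mu> * complex_of_real t) *\<^sub>C k *\<^sub>C x)"
          by (auto simp: not_less)
        have "T t (k *\<^sub>C x) - exp (\<mu> * complex_of_real t) *\<^sub>C k *\<^sub>C x
            = k *\<^sub>C (T t x - exp (\<mu> * complex_of_real t) *\<^sub>C x)"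
          using t(1)
          by (simp add: bounded_clinear_scaleC[OF C0_semigroupD(1)[OF T]] scaleC_scaleC
              complex_vector.scale_right_diff_distrib mult.commute)
        then have "\<epsilon> \<le> norm k * norm (T t x - exp (\<mu> * complex_of_real t) *\<^sub>C x)"
          using t(2) by (simp add: norm_scaleC)
        then have "\<epsilon> * norm x \<le> norm k * norm (T t x - exp (\<mu> * complex_of_real t) *\<^sub>C x) * norm x"
          by (intro mult_right_mono) auto
        also have "\<dots> = norm (T t x - exp (\<mu> * complex_of_real t) *\<^sub>C x)"
          using k by (simp add: mult.commute mult.left_commute)
        finally show ?thesis using t(1) by blast
      qed
      obtain \<delta> c L where "\<delta> > 0" "c > 0" and low:
        "\<And>l x. \<bar>Re l - \<omega>\<bar> < \<delta> \<Longrightarrow> x \<in> opdom A \<Longrightarrow> x \<in> common_kernel fs \<or> L \<le> norm l \<Longrightarrow>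
          c * norm x \<le> norm (shifted l A x)"
        using lower_bounds_of_not_almost_exponential[OF T fs t0 \<epsilon> far] unfolding assms(3) by metis
      moreover have "\<forall>f\<in>set fs. bounded_clinear f"
        using fs by (auto simp: adjoint_dom_def)
      ultimately show False
        using no_lower_bounds_near_resolvent_bound[OF \<omega>] by blast
    qed
  qed
  with \<omega> show ?thesis by blast
qed

end
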